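(* Let $L>0$ be a constant. There is a constant $C>0$ such that the following holds. Let $\mathcal{H}$ be an $r$-bounded, $\kappa$-spread hypergraph, let $X=V(\mathcal{H})$ and $N=|X|$, and let the elements of $X$ be randomly colored (uniformly and independently) from $Q=[q]$, where $q\ge r$. Suppose also that (i) $\kappa\ge Lr$, and (ii) $N\le \kappa^2 r/\log^5 r$. If $$m\ge \frac{(C\log_2 r)\,|X|}{\kappa},$$ then w.h.p. (that is, with probability tending to $1$ as $r\to\infty$) $X_m$ contains a rainbow colored edge of $\mathcal{H}$.
   Context: A hypergraph $\mathcal{H}$ with finite vertex set $X=V(\mathcal{H})$ is thought of as a (nonempty) set of edges, each a subset of $X$. It is $r$-bounded if $|e|\le r$ for every $e\in\mathcal{H}$. For $S\subseteq X$ let $\langle S\rangle=\{T: S\subseteq T\subseteq X\}$. $\mathcal{H}$ is $\kappa$-spread if $|\mathcal{H}\cap\langle S\rangle|\le |\mathcal{H}|/\kappa^{|S|}$ for all $S\subseteq X$. $X_m$ denotes a uniformly random $m$-subset of $X$ (independent of the coloring). Each element of $X$ receives a color chosen uniformly and independently from $[q]=\{1,\dots,q\}$. A set $S\subseteq X$ is rainbow colored if no two elements of $S$ have the same color. The parameters $\mathcal{H},X,\kappa,q,m$ may vary with $r$, while $L$ and $C$ are constants; all asymptotics, including w.h.p., are as $r\to\infty$. *)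

theory Defs
  imports "HOL-Probability.Probability"
begin

definition hypergraph :: "'a set \<Rightarrow> 'a set set \<Rightarrow> bool" where
  "hypergraph X H \<longleftrightarrow> finite X \<and> H \<noteq> {} \<and> (\<forall>e\<in>H. e \<subseteq> X)"

definition bounded_edges :: "nat \<Rightarrow> 'a set set \<Rightarrow> bool" where
  "bounded_edges r H \<longleftrightarrow> (\<forall>e\<in>H. card e \<le> r)"

definition up_set :: "'a set \<Rightarrow> 'a set \<Rightarrow> 'a set set" where
  "up_set X S = {T. S \<subseteq> T \<and> T \<subseteq> X}"

definition spread :: "real \<Rightarrow> 'a set \<Rightarrow> 'a set set \<Rightarrow> bool" where
  "spread \<kappa> X H \<longleftrightarrow>
     (\<forall>S\<subseteq>X. real (card (H \<inter> up_set X S)) \<le> real (card H) / \<kappa> ^ card S)"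

definition rainbow :: "('a \<Rightarrow> nat) \<Rightarrow> 'a set \<Rightarrow> bool" where
  "rainbow c S \<longleftrightarrow> inj_on c S"

(* Only meaningful for m \<le> card X: otherwise the set of m-subsets is empty
   and pmf_of_set is unspecified. *)
definition random_subset :: "'a set \<Rightarrow> nat \<Rightarrow> 'a set pmf" where
  "random_subset X m = pmf_of_set {S. S \<subseteq> X \<and> card S = m}"

(* Colorings are functions on the whole type; outside X they take the dummy
   value 0, which is not a color. *)
definition random_coloring :: "'a set \<Rightarrow> nat \<Rightarrow> ('a \<Rightarrow> nat) pmf" where
  "random_coloring X q = Pi_pmf X 0 (\<lambda>_. pmf_of_set {1..q})"

(* pair_pmf makes the random subset and the coloring independent. *)
definition prob_rainbow_edge :: "'a set \<Rightarrow> 'a set set \<Rightarrow> nat \<Rightarrow> nat \<Rightarrow> real" where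
  "prob_rainbow_edge X H q m =
     measure_pmf.prob (pair_pmf (random_subset X m) (random_coloring X q))
       {(Xm, c). \<exists>e\<in>H. e \<subseteq> Xm \<and> rainbow c e}"

end

theory Submission
  imports Defs "HOL-Real_Asymp.Real_Asymp"
begin

text \<open>A rainbow edge is an edge of the hypergraph on \<open>X \<times> Q\<close> whose edges are the graphs of
  injective colourings of edges of \<open>H\<close>. Since \<open>q (q - 1) \<dots> (q - s + 1) \<ge> (q / e) ^ s\<close>, this hypergraph,
  suitably weighted, is \<open>\<kappa> q / e\<close>-spread, so the minimum fragment argument of Park and Pham applies to
  it at density \<open>p / q\<close>. About \<open>log r\<close> rounds of density \<open>O(1 / \<kappa>)\<close> halve the edge size down to
  \<open>O(log log r)\<close>, and one round of density \<open>O(log r / \<kappa>)\<close> finishes, with failure probability \<open>o(1)\<close>.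
  A vertex with exactly one random colour does at least as well as one with independent
  colours, by a union bound in each fibre. Markov's inequality passes from binomial subsets of \<open>X\<close>
  to \<open>m\<close>-subsets.\<close>

text \<open>A vertex never carries two colours, so the coloured random set is not a binomial subset
  of \<open>X \<times> Q\<close>. The comparison is made one round at a time: a binomial set of
  density \<open>p / q\<close> is split off while the remainder keeps its single colours, which
  merges the comparison with the sprinkling. Errors are recorded as lost weight: every bound is a
  constant plus one minus the total weight. Being linear in the weight, it can be averaged over a
  round without conditioning. Halving cannot continue down to size one, because the error of the
  round ending at size \<open>s\<close> is only bounded by \<open>(1 / 4) ^ s\<close>, and about
  \<open>log r\<close> such errors must sum to \<open>o(1)\<close>. This makes \<open>s\<close> of
  order \<open>log log r\<close>, and removing the short sets that remain in a single round with
  error \<open>o(1)\<close> is what costs the factor \<open>log r\<close> in the density.\<close>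

section \<open>Expectation over binomial subsets\<close>

definition bin_exp :: "real \<Rightarrow> 'v set \<Rightarrow> ('v set \<Rightarrow> real) \<Rightarrow> real" where
  "bin_exp p V f = (\<Sum>W\<in>Pow V. p ^ card W * (1 - p) ^ card (V - W) * f W)"

lemma bin_exp_empty [simp]: "bin_exp p {} f = f {}"
  by (simp add: bin_exp_def)

lemma bin_exp_add: "bin_exp p V (\<lambda>W. f W + g W) = bin_exp p V f + bin_exp p V g"
  by (simp add: bin_exp_def ring_distribs sum.distrib)

lemma bin_exp_cmult: "bin_exp p V (\<lambda>W. a * f W) = a * bin_exp p V f"
  by (simp add: bin_exp_def sum_distrib_left mult_ac)

lemma bin_exp_sum: "bin_exp p V (\<lambda>W. \<Sum>j\<in>J. f j W) = (\<Sum>j\<in>J. bin_exp p V (f j))"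
  unfolding bin_exp_def sum_distrib_left by (rule sum.swap)

lemma bin_exp_mono:
  assumes "0 \<le> p" "p \<le> 1" "\<And>W. W \<subseteq> V \<Longrightarrow> f W \<le> g W"
  shows "bin_exp p V f \<le> bin_exp p V g"
  unfolding bin_exp_def using assms by (intro sum_mono mult_left_mono) auto

lemma bin_exp_cong: "(\<And>W. W \<subseteq> V \<Longrightarrow> f W = g W) \<Longrightarrow> bin_exp p V f = bin_exp p V g"
  unfolding bin_exp_def by (intro sum.cong) auto

lemma bin_exp_insert:
  assumes "finite V" "v \<notin> V"
  shows "bin_exp p (insert v V) f = (1 - p) * bin_exp p V f + p * bin_exp p V (\<lambda>W. f (insert v W))"
proof -
  have inj: "inj_on (insert v) (Pow V)"
    using assms(2) by (auto simp: inj_on_def)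
  have dis: "Pow V \<inter> insert v ` Pow V = {}"
    using assms(2) by auto
  have "bin_exp p (insert v V) f =
      (\<Sum>W\<in>Pow V. p ^ card W * (1 - p) ^ card (insert v V - W) * f W) +
      (\<Sum>W\<in>Pow V. p ^ card (insert v W) * (1 - p) ^ card (insert v V - insert v W) * f (insert v W))"
    unfolding bin_exp_def Pow_insert
    by (subst sum.union_disjoint) (use assms dis inj in \<open>auto simp: sum.reindex\<close>)
  also have "(\<Sum>W\<in>Pow V. p ^ card W * (1 - p) ^ card (insert v V - W) * f W) = (1 - p) * bin_exp p V f"
    unfolding bin_exp_def sum_distrib_left
  proof (intro sum.cong refl)
    fix W assume "W \<in> Pow V"
    then have "insert v V - W = insert v (V - W)" "v \<notin> V - W" "finite (V - W)"
      using assms by auto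
    then show "p ^ card W * (1 - p) ^ card (insert v V - W) * f W =
        (1 - p) * (p ^ card W * (1 - p) ^ card (V - W) * f W)" by simp
  qed
  also have "(\<Sum>W\<in>Pow V. p ^ card (insert v W) * (1 - p) ^ card (insert v V - insert v W) * f (insert v W))
      = p * bin_exp p V (\<lambda>W. f (insert v W))"
    unfolding bin_exp_def sum_distrib_left
  proof (intro sum.cong refl)
    fix W assume "W \<in> Pow V"
    then have "insert v V - insert v W = V - W" "v \<notin> W" "finite W"
      using assms by (auto dest: finite_subset)
    then show "p ^ card (insert v W) * (1 - p) ^ card (insert v V - insert v W) * f (insert v W) =
        p * (p ^ card W * (1 - p) ^ card (V - W) * f (insert v W))" by simp
  qed
  finally show ?thesis .
qed

lemma bin_exp_const: "finite V \<Longrightarrow> bin_exp p V (\<lambda>_. a) = a"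
  by (induction V rule: finite_induct) (auto simp: bin_exp_insert algebra_simps)

lemma bin_exp_Un:
  assumes "finite A" "finite B" "A \<inter> B = {}"
  shows "bin_exp p (A \<union> B) f = bin_exp p A (\<lambda>U. bin_exp p B (\<lambda>W. f (U \<union> W)))"
  using assms(1,3)
proof (induction A arbitrary: f rule: finite_induct)
  case (insert a A)
  then show ?case
    using assms(2) by (simp add: bin_exp_insert)
qed simp

lemma bin_exp_weight_sum:
  assumes "finite V"
  shows "bin_exp p V (\<lambda>W. \<Sum>v\<in>W. d v) = p * (\<Sum>v\<in>V. d v)"
  using assms
proof (induction V rule: finite_induct)
  case (insert v V)
  have "bin_exp p V (\<lambda>W. \<Sum>v\<in>insert v W. d v) = bin_exp p V (\<lambda>W. d v + (\<Sum>v\<in>W. d v))"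
    using insert by (intro bin_exp_cong) (auto simp: finite_subset subset_iff sum.insert_if)
  with insert show ?case
    by (simp add: bin_exp_insert bin_exp_add bin_exp_const algebra_simps)
qed simp

section \<open>Expectation over randomly coloured binomial subsets\<close>

text \<open>All of \<open>X\<close> is coloured, although \<open>f\<close> sees only the colours on
  \<open>Y\<close>; this matches \<open>random_coloring\<close>, including its dummy value 0 outside
  \<open>X\<close>.\<close>

definition col_exp :: "nat \<Rightarrow> real \<Rightarrow> 'a set \<Rightarrow> (('a \<times> nat) set \<Rightarrow> real) \<Rightarrow> real" where
  "col_exp q p X f = bin_exp p X (\<lambda>Y.
     (\<Sum>c\<in>PiE_dflt X 0 (\<lambda>_. {1..q}). f ((\<lambda>x. (x, c x)) ` Y)) / real (q ^ card X))"

lemma col_exp_empty [simp]: "col_exp q p {} f = f {}"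
  by (simp add: col_exp_def card_PiE_dflt)

lemma col_exp_add: "col_exp q p X (\<lambda>W. f W + g W) = col_exp q p X f + col_exp q p X g"
  by (simp add: col_exp_def sum.distrib add_divide_distrib bin_exp_add)

lemma col_exp_cmult: "col_exp q p X (\<lambda>W. a * f W) = a * col_exp q p X f"
  by (simp add: col_exp_def flip: sum_distrib_left bin_exp_cmult)

lemma col_exp_sum:
  assumes "finite J"
  shows "col_exp q p X (\<lambda>W. \<Sum>j\<in>J. f j W) = (\<Sum>j\<in>J. col_exp q p X (f j))"
  using assms
proof (induction J rule: finite_induct)
  case empty
  show ?case using col_exp_cmult[of q p X 0] by simp
next
  case (insert j J)
  then show ?case by (simp add: col_exp_add)
qed

lemma col_exp_bin_exp_swap:
  assumes "finite V"
  shows "col_exp q p' X (\<lambda>W'. bin_exp p V (\<lambda>W. f W W')) = bin_exp p V (\<lambda>W. col_exp q p' X (f W))"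
  using assms by (simp add: bin_exp_def col_exp_sum col_exp_cmult)

lemma col_exp_mono:
  assumes "0 \<le> p" "p \<le> 1" "\<And>W. f W \<le> g W"
  shows "col_exp q p X f \<le> col_exp q p X g"
  unfolding col_exp_def using assms by (intro bin_exp_mono divide_right_mono sum_mono) auto

lemma sum_PiE_dflt_insert:
  assumes "x \<notin> X"
  shows "(\<Sum>c\<in>PiE_dflt (insert x X) d B. g c) = (\<Sum>k\<in>B x. \<Sum>c\<in>PiE_dflt X d B. g (c(x := k)))"
proof -
  have "bij_betw (\<lambda>(k, c). c(x := k)) (B x \<times> PiE_dflt X d B) (PiE_dflt (insert x X) d B)"
  proof (rule bij_betwI[where g = "\<lambda>c. (c x, c(x := d))"])
    show "(\<lambda>(k, c). c(x := k)) \<in> B x \<times> PiE_dflt X d B \<rightarrow> PiE_dflt (insert x X) d B"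
      by (auto simp: PiE_dflt_def)
    show "(\<lambda>c. (c x, c(x := d))) \<in> PiE_dflt (insert x X) d B \<rightarrow> B x \<times> PiE_dflt X d B"
      using assms by (auto simp: PiE_dflt_def)
  qed (use assms in \<open>auto simp: PiE_dflt_def\<close>)
  from sum.reindex_bij_betw[OF this, of g] show ?thesis
    by (simp add: sum.cartesian_product case_prod_unfold)
qed

text \<open>The new vertex is absent with probability \<open>1 - p\<close> and otherwise has a
  uniform colour. Its average stands inside, as a function of the rest \<open>W\<close>, so that an
  induction hypothesis for all functions can be applied to it.\<close>

lemma col_exp_insert:
  assumes "finite X" "x \<notin> X" "q \<ge> 1"
  shows "col_exp q p (insert x X) f =
    col_exp q p X (\<lambda>W. (1 - p) * f W + p / real q * (\<Sum>k\<in>{1..q}. f (insert (x, k) W)))"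
proof -
  define avg where "avg X g = (\<Sum>c\<in>PiE_dflt X 0 (\<lambda>_. {1..q}). g c) / real (q ^ card X)"
    for X :: "'a set" and g :: "('a \<Rightarrow> nat) \<Rightarrow> real"
  have avg: "avg (insert x X) g = (\<Sum>k\<in>{1..q}. avg X (\<lambda>c. g (c(x := k)))) / q" for g
    using assms by (simp add: avg_def sum_PiE_dflt_insert sum_divide_distrib mult.commute)
  have graph: "(\<lambda>y. (y, (c(x := k)) y)) ` Y = (\<lambda>y. (y, c y)) ` Y" if "Y \<subseteq> X" for c :: "'a \<Rightarrow> nat" and k Y
    using that assms(2) by (intro image_cong) auto
  have 1: "bin_exp p X (\<lambda>Y. avg (insert x X) (\<lambda>c. f ((\<lambda>y. (y, c y)) ` Y))) = col_exp q p X f"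
    unfolding col_exp_def
  proof (rule bin_exp_cong)
    fix Y assume "Y \<subseteq> X"
    then show "avg (insert x X) (\<lambda>c. f ((\<lambda>y. (y, c y)) ` Y)) =
      (\<Sum>c\<in>PiE_dflt X 0 (\<lambda>_. {1..q}). f ((\<lambda>x. (x, c x)) ` Y)) / real (q ^ card X)"
      using assms(3) by (simp only: avg graph) (simp add: avg_def)
  qed
  have 2: "bin_exp p X (\<lambda>Y. avg (insert x X) (\<lambda>c. f ((\<lambda>y. (y, c y)) ` insert x Y))) =
     1 / real q * (\<Sum>k\<in>{1..q}. col_exp q p X (\<lambda>W. f (insert (x, k) W)))"
    unfolding col_exp_def bin_exp_sum[symmetric] bin_exp_cmult[symmetric]
  proof (rule bin_exp_cong)
    fix Y assume "Y \<subseteq> X"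
    then show "avg (insert x X) (\<lambda>c. f ((\<lambda>y. (y, c y)) ` insert x Y)) = 1 / real q * (\<Sum>k = 1..q.
      (\<Sum>c\<in>PiE_dflt X 0 (\<lambda>_. {1..q}). f (insert (x, k) ((\<lambda>x. (x, c x)) ` Y))) / real (q ^ card X))"
      by (simp only: avg image_insert graph) (simp add: avg_def)
  qed
  have "col_exp q p (insert x X) f = (1 - p) * col_exp q p X f +
      p * (1 / real q * (\<Sum>k\<in>{1..q}. col_exp q p X (\<lambda>W. f (insert (x, k) W))))"
    unfolding 1[symmetric] 2[symmetric] unfolding avg_def col_exp_def
    using assms by (simp add: bin_exp_insert)
  then show ?thesis
    by (simp only: col_exp_add col_exp_cmult col_exp_sum[OF finite_atLeastAtMost]) simp
qed

lemma col_exp_const: "finite X \<Longrightarrow> q \<ge> 1 \<Longrightarrow> col_exp q p X (\<lambda>_. a) = a"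
  by (induction X rule: finite_induct) (auto simp: col_exp_insert algebra_simps)

section \<open>Comparing single colours with independent colours\<close>

text \<open>A union bound over the colours of a single vertex. Unlike being the indicator of a decreasing
  event, this condition is preserved by nonnegative linear combinations, so an expectation can be
  taken over one vertex at a time.\<close>

definition fibre_bound :: "'a \<Rightarrow> (('a \<times> nat) set \<Rightarrow> real) \<Rightarrow> bool" where
  "fibre_bound x f \<longleftrightarrow>
     (\<forall>W A. A \<subseteq> {x} \<times> UNIV \<and> finite A \<longrightarrow> f W - f (W \<union> A) \<le> (\<Sum>v\<in>A. f W - f (insert v W))) \<and>
     (\<forall>W v. f (insert v W) \<le> f W)"

lemma fibre_boundD:
  assumes "fibre_bound x f"
  shows "A \<subseteq> {x} \<times> UNIV \<Longrightarrow> finite A \<Longrightarrow> f W - f (W \<union> A) \<le> (\<Sum>v\<in>A. f W - f (insert v W))"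
    and "f (insert v W) \<le> f W"
  using assms unfolding fibre_bound_def by blast+

lemma fibre_bound_insert:
  assumes "fibre_bound x f"
  shows "fibre_bound x (\<lambda>W. f (insert v W))"
proof -
  have "f (insert v (insert w W)) \<le> f (insert v W)" for w W
    using fibre_boundD(2)[OF assms, of w "insert v W"] by (simp add: insert_commute)
  moreover have "f (insert v W) - f (insert v (W \<union> A)) \<le> (\<Sum>w\<in>A. f (insert v W) - f (insert v (insert w W)))"
    if "A \<subseteq> {x} \<times> UNIV" "finite A" for W A
    using fibre_boundD(1)[OF assms that, of "insert v W"] by (simp add: insert_commute)
  ultimately show ?thesis
    unfolding fibre_bound_def by blast
qed

lemma fibre_bound_add:
  assumes "fibre_bound x f" "fibre_bound x g"
  shows "fibre_bound x (\<lambda>W. f W + g W)"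
  unfolding fibre_bound_def
proof (intro conjI allI impI; (elim conjE)?)
  fix W and A :: "('a \<times> nat) set"
  assume A: "A \<subseteq> {x} \<times> UNIV" "finite A"
  have "(\<Sum>v\<in>A. f W + g W - (f (insert v W) + g (insert v W))) =
      (\<Sum>v\<in>A. f W - f (insert v W)) + (\<Sum>v\<in>A. g W - g (insert v W))"
    unfolding sum.distrib[symmetric] by (intro sum.cong) auto
  then show "f W + g W - (f (W \<union> A) + g (W \<union> A)) \<le>
      (\<Sum>v\<in>A. f W + g W - (f (insert v W) + g (insert v W)))"
    using fibre_boundD(1)[OF assms(1) A, of W] fibre_boundD(1)[OF assms(2) A, of W] by linarith
next
  fix W v
  show "f (insert v W) + g (insert v W) \<le> f W + g W"
    by (intro add_mono fibre_boundD(2)[OF assms(1)] fibre_boundD(2)[OF assms(2)])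
qed

lemma fibre_bound_cmult:
  assumes "a \<ge> 0" "fibre_bound x f"
  shows "fibre_bound x (\<lambda>W. a * f W)"
  unfolding fibre_bound_def right_diff_distrib[symmetric] sum_distrib_left[symmetric]
  by (intro conjI allI impI mult_left_mono assms(1) fibre_boundD[OF assms(2)]; (elim conjE)?; assumption)

lemma fibre_bound_sum:
  assumes "finite J" "\<And>j. j \<in> J \<Longrightarrow> fibre_bound x (f j)"
  shows "fibre_bound x (\<lambda>W. \<Sum>j\<in>J. f j W)"
  using assms by (induction J rule: finite_induct) (auto intro: fibre_bound_add, simp add: fibre_bound_def)

text \<open>With a single colour the expected drop from \<open>f U\<close> is exactly
  \<open>(p + p') / q\<close> times the sum \<open>D\<close> of the drops of the individual colours.
  With the random set \<open>A\<close> and a further colour, the union bound limits the expected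
  drop to \<open>p / q * D + p' / q * D\<close>, the same amount.\<close>

lemma fibre_bound_single_colour_le:
  assumes f: "fibre_bound x f" and p: "0 \<le> p" "0 \<le> p'" "p + p' \<le> 1" and q: "q \<ge> 1"
  shows "(1 - (p + p')) * f U + (p + p') / real q * (\<Sum>k\<in>{1..q}. f (insert (x, k) U)) \<le>
    bin_exp (p / real q) ({x} \<times> {1..q}) (\<lambda>A. (1 - p') * f (A \<union> U) +
      p' / real q * (\<Sum>k\<in>{1..q}. f (insert (x, k) (A \<union> U))))"
proof -
  define d where "d v = f U - f (insert v U)" for v
  define D where "D = (\<Sum>k\<in>{1..q}. d (x, k))"
  have d0: "d v \<ge> 0" for v using fibre_boundD(2)[OF f] by (simp add: d_def)
  have drop: "f U - (\<Sum>v\<in>A. d v) \<le> f (A \<union> U)" if "A \<subseteq> {x} \<times> UNIV" "finite A" for A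
    using fibre_boundD(1)[OF f that, of U] by (simp add: d_def Un_commute)
  have D: "D = real q * f U - (\<Sum>k\<in>{1..q}. f (insert (x, k) U))"
    by (simp add: D_def d_def sum_subtractf)
  have "{x} \<times> {1..q} = Pair x ` {1..q}"
    by auto
  then have D_fibre: "(\<Sum>v\<in>{x} \<times> {1..q}. d v) = D"
    by (simp add: D_def sum.reindex inj_on_def)
  have "(1 - (p + p')) * f U + (p + p') / real q * (\<Sum>k\<in>{1..q}. f (insert (x, k) U)) =
     f U - p' / real q * D - p / real q * D"
    unfolding D using q by (simp add: field_simps)
  also have "\<dots> = bin_exp (p / real q) ({x} \<times> {1..q}) (\<lambda>A. (f U - p' / real q * D) + (-1) * (\<Sum>v\<in>A. d v))"
    by (simp only: bin_exp_add bin_exp_cmult)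
      (simp add: bin_exp_const bin_exp_weight_sum D_fibre del: One_nat_def)
  also have "\<dots> \<le> bin_exp (p / real q) ({x} \<times> {1..q}) (\<lambda>A. (1 - p') * f (A \<union> U) +
      p' / real q * (\<Sum>k\<in>{1..q}. f (insert (x, k) (A \<union> U))))"
  proof (rule bin_exp_mono)
    fix A assume A: "A \<subseteq> {x} \<times> {1..q}"
    then have finA: "finite A" by (rule finite_subset) auto
    \<comment> \<open>The extra colour may already lie in \<open>A\<close>; the drop
      \<open>d (x, k)\<close> is then counted twice, which is harmless since drops are
      nonnegative.\<close>
    have le: "f U - (\<Sum>v\<in>A. d v) - d (x, k) \<le> f (insert (x, k) (A \<union> U))" for k
    proof -
      have "(\<Sum>v\<in>insert (x, k) A. d v) \<le> (\<Sum>v\<in>A. d v) + d (x, k)"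
        using finA d0[of "(x, k)"] by (simp add: sum.insert_if)
      moreover have "f U - (\<Sum>v\<in>insert (x, k) A. d v) \<le> f (insert (x, k) A \<union> U)"
        by (rule drop) (use A finA in auto)
      ultimately show ?thesis by simp
    qed
    have "f U - p' / real q * D + (-1) * (\<Sum>v\<in>A. d v) =
        (1 - p') * (f U - (\<Sum>v\<in>A. d v)) + p' / real q * (\<Sum>k\<in>{1..q}. f U - (\<Sum>v\<in>A. d v) - d (x, k))"
      using q by (simp add: sum_subtractf sum.distrib D_def[symmetric] field_simps del: One_nat_def)
    also have "\<dots> \<le> (1 - p') * f (A \<union> U) + p' / real q * (\<Sum>k\<in>{1..q}. f (insert (x, k) (A \<union> U)))"
      using p A finA by (intro add_mono mult_left_mono sum_mono le drop) auto
    finally show "f U - p' / real q * D + (-1) * (\<Sum>v\<in>A. d v) \<le> \<dots>" .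
  qed (use p q in \<open>auto simp: divide_le_eq\<close>)
  finally show ?thesis .
qed

text \<open>Following McDiarmid, the coloured set is exposed vertex by vertex: giving a vertex one colour
  is at least as likely to hit a prescribed set of colours as deciding the colours independently.\<close>

lemma col_exp_split:
  assumes "finite X" and p: "0 \<le> p" "0 \<le> p'" "p + p' \<le> 1" and q: "q \<ge> 1"
    and "\<And>x. x \<in> X \<Longrightarrow> fibre_bound x f"
  shows "col_exp q (p + p') X f \<le>
    bin_exp (p / real q) (X \<times> {1..q}) (\<lambda>W. col_exp q p' X (\<lambda>W'. f (W \<union> W')))"
  using assms(1,6)
proof (induction X arbitrary: f rule: finite_induct)
  case (insert x X)
  \<comment> \<open>Both functions average out the vertex \<open>x\<close>: \<open>h\<close> at the
    full density, \<open>g\<close> at the density left after the split. The induction hypothesis is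
    applied to \<open>h\<close>, and only then is \<open>x\<close> itself compared.\<close>
  define h where "h W = (1 - (p + p')) * f W + (p + p') / real q * (\<Sum>k\<in>{1..q}. f (insert (x, k) W))" for W
  define g where "g U = (1 - p') * f U + p' / real q * (\<Sum>k\<in>{1..q}. f (insert (x, k) U))" for U
  have "fibre_bound y h" if "y \<in> X" for y
    unfolding h_def using p q insert.prems that
    by (intro fibre_bound_add fibre_bound_cmult fibre_bound_sum fibre_bound_insert) auto
  then have "col_exp q (p + p') X h \<le>
      bin_exp (p / real q) (X \<times> {1..q}) (\<lambda>W. col_exp q p' X (\<lambda>W'. h (W \<union> W')))"
    by (rule insert.IH)
  also have "\<dots> \<le> bin_exp (p / real q) (X \<times> {1..q}) (\<lambda>W. col_exp q p' X
      (\<lambda>W'. bin_exp (p / real q) ({x} \<times> {1..q}) (\<lambda>A. g (A \<union> (W \<union> W')))))"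
    unfolding h_def g_def using p q insert.prems
    by (intro bin_exp_mono col_exp_mono fibre_bound_single_colour_le) (auto simp: divide_le_eq)
  also have "\<dots> = bin_exp (p / real q) (X \<times> {1..q}) (\<lambda>W. bin_exp (p / real q) ({x} \<times> {1..q})
      (\<lambda>A. col_exp q p' X (\<lambda>W'. g ((W \<union> A) \<union> W'))))"
    by (simp add: col_exp_bin_exp_swap Un_ac)
  also have "\<dots> = bin_exp (p / real q) (X \<times> {1..q} \<union> {x} \<times> {1..q}) (\<lambda>W. col_exp q p' X (\<lambda>W'. g (W \<union> W')))"
    using insert.hyps by (subst bin_exp_Un) auto
  also have "X \<times> {1..q} \<union> {x} \<times> {1..q} = insert x X \<times> {1..q}"
    by auto
  also have "bin_exp (p / real q) (insert x X \<times> {1..q}) (\<lambda>W. col_exp q p' X (\<lambda>W'. g (W \<union> W'))) =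
      bin_exp (p / real q) (insert x X \<times> {1..q}) (\<lambda>W. col_exp q p' (insert x X) (\<lambda>W'. f (W \<union> W')))"
    using insert.hyps q by (simp add: col_exp_insert g_def)
  finally show ?case
    using insert q by (simp add: col_exp_insert h_def)
qed simp

section \<open>Minimum fragments and their expected weight\<close>

text \<open>The minimum fragment of Park and Pham: the least that has to be added to \<open>W\<close> in order to
  contain some member of the family inside \<open>W \<union> S i\<close>.\<close>

definition frag :: "'i set \<Rightarrow> ('i \<Rightarrow> 'v set) \<Rightarrow> 'v set \<Rightarrow> 'i \<Rightarrow> 'v set" where
  "frag I S W i = S (arg_min (\<lambda>j. card (S j - W)) (\<lambda>j. j \<in> I \<and> S j \<subseteq> W \<union> S i)) - W"

lemma frag_witness:
  assumes "i \<in> I"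
  obtains j where "j \<in> I" "S j \<subseteq> W \<union> S i" "frag I S W i = S j - W"
  using arg_min_natI[of "\<lambda>j. j \<in> I \<and> S j \<subseteq> W \<union> S i" i "\<lambda>j. card (S j - W)"] assms
  unfolding frag_def by blast

lemma frag_minimal:
  assumes "j \<in> I" "S j \<subseteq> W \<union> S i"
  shows "card (frag I S W i) \<le> card (S j - W)"
  unfolding frag_def
  by (rule arg_min_nat_le[where P = "\<lambda>j. j \<in> I \<and> S j \<subseteq> W \<union> S i" and m = "\<lambda>j. card (S j - W)"])
    (use assms in auto)

lemma frag_subset: "i \<in> I \<Longrightarrow> frag I S W i \<subseteq> S i"
  by (rule frag_witness[of i I S W]) auto

text \<open>The total weight may be less than one: each round discards the members with large fragments.
  Taking \<open>A = {}\<close> in the last condition bounds it by one.\<close>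

definition spread_system ::
  "('a \<times> 'c) set \<Rightarrow> nat \<Rightarrow> real \<Rightarrow> 'i set \<Rightarrow> ('i \<Rightarrow> ('a \<times> 'c) set) \<Rightarrow> ('i \<Rightarrow> real) \<Rightarrow> bool" where
  "spread_system V s b I S u \<longleftrightarrow> finite I \<and>
     (\<forall>i\<in>I. 0 \<le> u i \<and> S i \<subseteq> V \<and> inj_on fst (S i) \<and> card (S i) \<le> s) \<and>
     (\<forall>A\<subseteq>V. (\<Sum>i | i \<in> I \<and> A \<subseteq> S i. u i) \<le> b ^ card A)"

text \<open>Indices and weights are kept and only the sets shrink. A set inside the fragment of
  \<open>i\<close> also lies inside \<open>S i\<close>, so the old spread bound survives with the
  same \<open>b\<close>.\<close>

lemma spread_system_frag:
  assumes "spread_system V s b I S u"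
  shows "spread_system V s' b {i \<in> I. card (frag I S W i) \<le> s'} (frag I S W) u"
  unfolding spread_system_def
proof (intro conjI ballI allI impI)
  fix i assume "i \<in> {i \<in> I. card (frag I S W i) \<le> s'}"
  then have i: "i \<in> I" "card (frag I S W i) \<le> s'" by auto
  with assms frag_subset[OF i(1), of S W]
  show "0 \<le> u i" "frag I S W i \<subseteq> V" "inj_on fst (frag I S W i)" "card (frag I S W i) \<le> s'"
    by (auto simp: spread_system_def intro: inj_on_subset)
next
  fix A assume "A \<subseteq> V"
  have "(\<Sum>i | i \<in> {i \<in> I. card (frag I S W i) \<le> s'} \<and> A \<subseteq> frag I S W i. u i) \<le> (\<Sum>i | i \<in> I \<and> A \<subseteq> S i. u i)"
    using assms by (intro sum_mono2) (auto simp: spread_system_def dest: frag_subset[THEN subsetD])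
  also have "\<dots> \<le> b ^ card A"
    using assms \<open>A \<subseteq> V\<close> by (auto simp: spread_system_def)
  finally show "(\<Sum>i | i \<in> {i \<in> I. card (frag I S W i) \<le> s'} \<and> A \<subseteq> frag I S W i. u i) \<le> b ^ card A" .
qed (use assms in \<open>auto simp: spread_system_def\<close>)

text \<open>The exact cost of adding \<open>B\<close> is the factor
  \<open>((1 - p) / p) ^ card B\<close>; the numerator is bounded by one.\<close>

lemma binomial_weight_remove:
  fixes p :: real
  assumes "finite V" "W \<union> B \<subseteq> V" "W \<inter> B = {}" "0 < p" "p \<le> 1"
  shows "p ^ card W * (1 - p) ^ card (V - W) \<le>
    p ^ card (W \<union> B) * (1 - p) ^ card (V - (W \<union> B)) / p ^ card B"
proof -
  have fin: "finite W" "finite B" "finite (V - (W \<union> B))"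
    using assms finite_subset by blast+
  have "card (V - W) = card (V - (W \<union> B) \<union> B)"
    by (rule arg_cong[where f = card]) (use assms in auto)
  also have "\<dots> = card (V - (W \<union> B)) + card B"
    using fin by (intro card_Un_disjoint) auto
  finally have "card (V - W) = card (V - (W \<union> B)) + card B" .
  then have "p ^ card W * (1 - p) ^ card (V - W) =
      p ^ card W * (1 - p) ^ card (V - (W \<union> B)) * (1 - p) ^ card B"
    by (simp add: power_add)
  also have "\<dots> \<le> p ^ card W * (1 - p) ^ card (V - (W \<union> B)) * 1"
    using assms by (intro mult_left_mono power_le_one) auto
  also have "\<dots> = p ^ card (W \<union> B) * (1 - p) ^ card (V - (W \<union> B)) / p ^ card B"
    using fin assms by (simp add: card_Un_disjoint power_add)
  finally show ?thesis .
qed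

text \<open>If \<open>B\<close> is a fragment for \<open>W\<close> and \<open>Z = W \<union> B\<close>, then by minimality \<open>B\<close> is contained in every
  member inside \<open>Z\<close>. So \<open>Z\<close> determines \<open>B\<close> up to at most \<open>s choose t\<close> possibilities, and passing
  from \<open>W\<close> to \<open>Z\<close> costs a factor \<open>p ^ t\<close>.\<close>

lemma bin_exp_frag_weight:
  assumes V: "finite V" and p: "0 < p" "p \<le> 1" and b: "b \<ge> 0" and sys: "spread_system V s b I S u"
  shows "bin_exp p V (\<lambda>W. \<Sum>i | i \<in> I \<and> card (frag I S W i) = t. u i) \<le> real (s choose t) * (b / p) ^ t"
proof -
  define T where "T W = frag I S W ` {i \<in> I. card (frag I S W i) = t}" for W
  \<comment> \<open>One member inside \<open>Z\<close>, chosen from \<open>Z\<close> alone and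
    without knowledge of \<open>W\<close>. The default \<open>{}\<close> keeps the bounds on its
    size and position valid for every \<open>Z\<close>.\<close>
  define E where "E Z = (if \<exists>i\<in>I. S i \<subseteq> Z then S (SOME i. i \<in> I \<and> S i \<subseteq> Z) else {})" for Z
  define T' where "T' Z = {B. B \<subseteq> E Z \<and> card B = t}" for Z
  define w where "w W = p ^ card W * (1 - p) ^ card (V - W)" for W
  have finI: "finite I" and SV: "\<And>i. i \<in> I \<Longrightarrow> S i \<subseteq> V" and u0: "\<And>i. i \<in> I \<Longrightarrow> 0 \<le> u i"
    and Ss: "\<And>i. i \<in> I \<Longrightarrow> card (S i) \<le> s"
    and spr: "\<And>A. A \<subseteq> V \<Longrightarrow> (\<Sum>i | i \<in> I \<and> A \<subseteq> S i. u i) \<le> b ^ card A"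
    using sys by (auto simp: spread_system_def)
  have w0: "0 \<le> w W" for W using p by (simp add: w_def)
  have E: "\<exists>k\<in>I. E Z = S k \<and> S k \<subseteq> Z" if "\<exists>i\<in>I. S i \<subseteq> Z" for Z
  proof -
    have "\<exists>i. i \<in> I \<and> S i \<subseteq> Z" using that by blast
    then have "(SOME i. i \<in> I \<and> S i \<subseteq> Z) \<in> I \<and> S (SOME i. i \<in> I \<and> S i \<subseteq> Z) \<subseteq> Z"
      by (rule someI_ex)
    with that show ?thesis unfolding E_def by (intro bexI[of _ "SOME i. i \<in> I \<and> S i \<subseteq> Z"]) simp_all
  qed
  have "E Z \<subseteq> V \<and> card (E Z) \<le> s" for Z
  proof (cases "\<exists>i\<in>I. S i \<subseteq> Z")
    case True
    then show ?thesis using E[OF True] SV Ss by metis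
  qed (simp add: E_def)
  then have finE: "finite (E Z)" and cardE: "card (E Z) \<le> s" for Z
    using V finite_subset by blast+
  have finT': "finite (T' Z)" for Z
    unfolding T'_def using finE by (auto intro: finite_subset[of _ "Pow (E Z)"])
  have cardT': "real (card (T' Z)) \<le> real (s choose t)" for Z
    unfolding T'_def using finE cardE by (simp add: n_subsets binomial_right_mono)
  have "(\<Sum>W\<in>Pow V. \<Sum>B\<in>T W. w W) = (\<Sum>(W, B)\<in>Sigma (Pow V) T. w W)"
    using V finI by (intro sum.Sigma) (auto simp: T_def)
  also have "\<dots> \<le> (\<Sum>(Z, B)\<in>Sigma (Pow V) T'. w Z / p ^ t)"
  \<comment> \<open>The pair \<open>(W, B)\<close> is recovered from
    \<open>(W \<union> B, B)\<close> because a fragment is disjoint from \<open>W\<close>.\<close>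
  proof (rule sum_le_included[where i = "\<lambda>(Z, B). (Z - B, B)"])
    show "\<forall>x\<in>Sigma (Pow V) T. \<exists>y\<in>Sigma (Pow V) T'. (case y of (Z, B) \<Rightarrow> (Z - B, B)) = x \<and>
        (case x of (W, B) \<Rightarrow> w W) \<le> (case y of (Z, B) \<Rightarrow> w Z / p ^ t)"
    proof
      fix x assume "x \<in> Sigma (Pow V) T"
      then obtain W i where W: "W \<subseteq> V" and i: "i \<in> I" "card (frag I S W i) = t" and x: "x = (W, frag I S W i)"
        by (auto simp: T_def)
      define B where "B = frag I S W i"
      obtain j where j: "j \<in> I" "S j \<subseteq> W \<union> S i" "B = S j - W"
        unfolding B_def by (rule frag_witness[OF i(1), of S W]) auto
      have "\<exists>i\<in>I. S i \<subseteq> W \<union> B" using j by auto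
      then obtain k where k: "E (W \<union> B) = S k" "k \<in> I" "S k \<subseteq> W \<union> B"
        using E[of "W \<union> B"] by blast
      \<comment> \<open>The chosen member \<open>S k\<close> lies in \<open>W \<union> B\<close>,
        hence in \<open>W \<union> S i\<close>, so it competes in the minimum defining
        \<open>B\<close>. As \<open>S k - W\<close> lies in \<open>B\<close> and is not smaller, the
        two coincide.\<close>
      have "card B \<le> card (S k - W)"
        unfolding B_def using k j by (intro frag_minimal) (auto simp: B_def)
      moreover have "S k - W \<subseteq> B" using k(3) by auto
      moreover have "finite B" using j(1,3) SV finite_subset[OF _ V] by auto
      ultimately have "S k - W = B" by (intro card_seteq) auto
      then have "B \<in> T' (W \<union> B)"
        using k(1) i(2) by (auto simp: T'_def B_def)
      moreover have "w W \<le> w (W \<union> B) / p ^ t"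
        using binomial_weight_remove[OF V, of W B p] W j SV[OF j(1)] p i(2)
        unfolding w_def B_def[symmetric] by auto
      moreover have "W \<union> B \<subseteq> V" "(W \<union> B) - B = W"
        using W j SV[OF j(1)] by auto
      ultimately show "\<exists>y\<in>Sigma (Pow V) T'. (case y of (Z, B) \<Rightarrow> (Z - B, B)) = x \<and>
          (case x of (W, B) \<Rightarrow> w W) \<le> (case y of (Z, B) \<Rightarrow> w Z / p ^ t)"
        unfolding x B_def[symmetric] by (intro bexI[of _ "(W \<union> B, B)"]) auto
    qed
  qed (use V finI finT' w0 p in \<open>auto simp: T_def\<close>)
  also have "\<dots> = (\<Sum>Z\<in>Pow V. real (card (T' Z)) * (w Z / p ^ t))"
    using V finT' by (subst sum.Sigma[symmetric]) auto
  also have "\<dots> \<le> (\<Sum>Z\<in>Pow V. real (s choose t) * (w Z / p ^ t))"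
    using w0 p cardT' by (intro sum_mono mult_right_mono) auto
  also have "\<dots> = real (s choose t) / p ^ t * bin_exp p V (\<lambda>_. 1)"
    by (simp add: bin_exp_def w_def sum_distrib_left)
  finally have count: "(\<Sum>W\<in>Pow V. \<Sum>B\<in>T W. w W) \<le> real (s choose t) / p ^ t"
    using V by (simp add: bin_exp_const)
  have "bin_exp p V (\<lambda>W. \<Sum>i | i \<in> I \<and> card (frag I S W i) = t. u i) \<le> bin_exp p V (\<lambda>W. b ^ t * real (card (T W)))"
  proof (rule bin_exp_mono)
    fix W assume "W \<subseteq> V"
    \<comment> \<open>Members are grouped by their fragment \<open>B\<close>. All members of a group
      contain \<open>B\<close>, so spread bounds the weight of the group by
      \<open>b ^ t\<close>.\<close>
    have "(\<Sum>i | i \<in> I \<and> card (frag I S W i) = t. u i) =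
        (\<Sum>B\<in>T W. \<Sum>i | i \<in> {i \<in> I. card (frag I S W i) = t} \<and> frag I S W i = B. u i)"
      unfolding T_def using finI by (subst sum.image_gen[where g = "frag I S W"]) auto
    also have "\<dots> \<le> (\<Sum>B\<in>T W. b ^ t)"
    proof (rule sum_mono)
      fix B assume B: "B \<in> T W"
      then have "B \<subseteq> V" "card B = t"
        using frag_subset[of _ I S W] SV by (fastforce simp: T_def)+
      have "(\<Sum>i | i \<in> {i \<in> I. card (frag I S W i) = t} \<and> frag I S W i = B. u i) \<le> (\<Sum>i | i \<in> I \<and> B \<subseteq> S i. u i)"
        using finI u0 frag_subset[of _ I S W] by (intro sum_mono2) auto
      also have "\<dots> \<le> b ^ t"
        using spr[OF \<open>B \<subseteq> V\<close>] \<open>card B = t\<close> by simp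
      finally show "(\<Sum>i | i \<in> {i \<in> I. card (frag I S W i) = t} \<and> frag I S W i = B. u i) \<le> b ^ t" .
    qed
    finally show "(\<Sum>i | i \<in> I \<and> card (frag I S W i) = t. u i) \<le> b ^ t * real (card (T W))"
      by (simp add: mult.commute)
  qed (use p in auto)
  also have "\<dots> = b ^ t * (\<Sum>W\<in>Pow V. \<Sum>B\<in>T W. w W)"
    by (simp add: bin_exp_cmult) (simp add: bin_exp_def w_def mult_ac)
  also have "\<dots> \<le> b ^ t * (real (s choose t) / p ^ t)"
    using b count by (intro mult_left_mono) auto
  finally show ?thesis
    by (simp add: power_divide mult_ac)
qed

section \<open>Failure probability over the rounds\<close>

definition fail :: "'i set \<Rightarrow> ('i \<Rightarrow> 'v set) \<Rightarrow> 'v set \<Rightarrow> real" where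
  "fail I S W = (if \<exists>i\<in>I. S i \<subseteq> W then 0 else 1)"

text \<open>A set that is injective under \<open>fst\<close> meets the fibre over \<open>x\<close>
  in at most one point. So if adding \<open>A\<close> completes some \<open>S i\<close>, a single
  element of \<open>A\<close> already does.\<close>

lemma fibre_bound_fail:
  assumes "\<And>i. i \<in> I \<Longrightarrow> inj_on fst (S i)"
  shows "fibre_bound x (fail I S)"
  unfolding fibre_bound_def
proof (intro conjI allI impI)
  fix W v show "fail I S (insert v W) \<le> fail I S W"
    by (auto simp: fail_def)
next
  fix W A :: "('b \<times> nat) set" assume "A \<subseteq> {x} \<times> UNIV \<and> finite A"
  then have A: "A \<subseteq> {x} \<times> UNIV" "finite A" by auto
  have nonneg: "0 \<le> fail I S W - fail I S (insert v W)" for v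
    by (auto simp: fail_def)
  show "fail I S W - fail I S (W \<union> A) \<le> (\<Sum>v\<in>A. fail I S W - fail I S (insert v W))"
  proof (cases "fail I S W = 1 \<and> fail I S (W \<union> A) = 0")
    case True
    then obtain i where i: "i \<in> I" "S i \<subseteq> W \<union> A" "\<not> S i \<subseteq> W"
      by (auto simp: fail_def split: if_splits)
    then obtain v where v: "v \<in> S i" "v \<in> A" by auto
    have "S i \<subseteq> insert v W"
    proof
      fix y assume y: "y \<in> S i"
      have "y = v" if "y \<in> A"
        using inj_onD[OF assms[OF i(1)], of y v] that v y A(1) by (metis SigmaE fst_conv singletonD subsetD)
      then show "y \<in> insert v W" using y i(2) by auto
    qed
    then have "fail I S W - fail I S (W \<union> A) = fail I S W - fail I S (insert v W)"
      using True i(1) by (auto simp: fail_def)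
    also have "\<dots> \<le> (\<Sum>v\<in>A. fail I S W - fail I S (insert v W))"
      using A(2) v(2) nonneg by (intro member_le_sum) auto
    finally show ?thesis .
  next
    case False
    then have "fail I S W - fail I S (W \<union> A) \<le> 0"
      by (auto simp: fail_def split: if_splits)
    moreover have "0 \<le> (\<Sum>v\<in>A. fail I S W - fail I S (insert v W))"
      by (rule sum_nonneg) (rule nonneg)
    ultimately show ?thesis by linarith
  qed
qed

text \<open>A fragment inside \<open>W'\<close> is \<open>S j - W\<close> for some member
  \<open>S j\<close>, which then lies in \<open>W \<union> W'\<close>. Discarding large fragments
  can only increase failure.\<close>

lemma fail_frag: "fail I S (W \<union> W') \<le> fail {i \<in> I. card (frag I S W i) \<le> s'} (frag I S W) W'"
proof (cases "\<exists>i\<in>I. frag I S W i \<subseteq> W'")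
  case True
  then obtain i j where "frag I S W i \<subseteq> W'" "j \<in> I" "frag I S W i = S j - W"
    using frag_witness[of _ I S W] by metis
  then have "\<exists>i\<in>I. S i \<subseteq> W \<union> W'" by blast
  then show ?thesis by (simp add: fail_def)
next
  case False
  then have "fail {i \<in> I. card (frag I S W i) \<le> s'} (frag I S W) W' = 1"
    by (auto simp: fail_def)
  then show ?thesis by (simp add: fail_def)
qed

text \<open>Discarding the fragments larger than \<open>s'\<close> raises the deficit
  \<open>1 - (\<Sum>i\<in>I. u i)\<close> by exactly their weight. Sorted by fragment size
  \<open>t\<close>, its expectation is controlled by \<open>bin_exp_frag_weight\<close> at density
  \<open>p / q\<close>, which turns \<open>b / (p / q)\<close> into
  \<open>b * q / p\<close>.\<close>

lemma col_exp_fail_step: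
  assumes X: "finite X" and q: "q \<ge> 1" and p: "0 < p" "0 \<le> p'" "p + p' \<le> 1" and b: "b \<ge> 0"
    and sys: "spread_system (X \<times> {1..q}) s b I S u"
    and rest: "\<And>J R. spread_system (X \<times> {1..q}) s' b J R u \<Longrightarrow>
      col_exp q p' X (fail J R) \<le> \<beta> + (1 - (\<Sum>i\<in>J. u i))"
  shows "col_exp q (p + p') X (fail I S) \<le>
    (\<Sum>t\<in>{s'<..s}. real (s choose t) * (b * real q / p) ^ t) + \<beta> + (1 - (\<Sum>i\<in>I. u i))"
proof -
  define V where "V = X \<times> {1..q}"
  define J where "J W = {i \<in> I. card (frag I S W i) \<le> s'}" for W
  note sys = sys[folded V_def]
  have V: "finite V" using X by (simp add: V_def)
  have finI: "finite I" and inj: "\<And>i. i \<in> I \<Longrightarrow> inj_on fst (S i)"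
    using sys by (auto simp: spread_system_def)
  have pq: "0 < p / real q" "p / real q \<le> 1"
    using p q by (auto simp: divide_le_eq)
  have "col_exp q (p + p') X (fail I S) \<le>
      bin_exp (p / real q) V (\<lambda>W. col_exp q p' X (\<lambda>W'. fail I S (W \<union> W')))"
    unfolding V_def using p q X inj by (intro col_exp_split fibre_bound_fail) auto
  also have "\<dots> \<le> bin_exp (p / real q) V (\<lambda>W. col_exp q p' X (fail (J W) (frag I S W)))"
    unfolding J_def using p pq by (intro bin_exp_mono col_exp_mono fail_frag) auto
  also have "\<dots> \<le> bin_exp (p / real q) V (\<lambda>W. (\<beta> + (1 - (\<Sum>i\<in>I. u i))) +
      (\<Sum>t\<in>{s'<..s}. \<Sum>i | i \<in> I \<and> card (frag I S W i) = t. u i))"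
  proof (rule bin_exp_mono)
    fix W assume "W \<subseteq> V"
    have "col_exp q p' X (fail (J W) (frag I S W)) \<le> \<beta> + (1 - (\<Sum>i\<in>J W. u i))"
      using spread_system_frag[OF sys] by (intro rest) (simp add: J_def V_def)
    moreover have "(\<Sum>i\<in>I. u i) = (\<Sum>i\<in>J W. u i) + (\<Sum>i\<in>I - J W. u i)"
      using finI by (subst add.commute, intro sum.subset_diff) (auto simp: J_def)
    moreover have "(\<Sum>i\<in>I - J W. u i) = (\<Sum>t\<in>{s'<..s}. \<Sum>i | i \<in> I - J W \<and> card (frag I S W i) = t. u i)"
    proof (intro sum.group[symmetric])
      have "card (frag I S W i) \<le> s" if "i \<in> I" for i
      proof -
        have "S i \<subseteq> V" "card (S i) \<le> s" using that sys by (auto simp: spread_system_def)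
        then show ?thesis
          using card_mono[OF _ frag_subset[OF that, of S W]] finite_subset[OF _ V] by fastforce
      qed
      then show "(\<lambda>i. card (frag I S W i)) ` (I - J W) \<subseteq> {s'<..s}"
        by (auto simp: J_def)
    qed (use finI in auto)
    moreover have "\<dots> = (\<Sum>t\<in>{s'<..s}. \<Sum>i | i \<in> I \<and> card (frag I S W i) = t. u i)"
      by (intro sum.cong arg_cong2[where f = sum]) (auto simp: J_def)
    ultimately show "col_exp q p' X (fail (J W) (frag I S W)) \<le> (\<beta> + (1 - (\<Sum>i\<in>I. u i))) +
        (\<Sum>t\<in>{s'<..s}. \<Sum>i | i \<in> I \<and> card (frag I S W i) = t. u i)"
      by linarith
  qed (use pq in auto)
  also have "\<dots> = (\<beta> + (1 - (\<Sum>i\<in>I. u i))) +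
      (\<Sum>t\<in>{s'<..s}. bin_exp (p / real q) V (\<lambda>W. \<Sum>i | i \<in> I \<and> card (frag I S W i) = t. u i))"
    by (simp add: bin_exp_add bin_exp_sum bin_exp_const[OF V])
  also have "\<dots> \<le> (\<beta> + (1 - (\<Sum>i\<in>I. u i))) + (\<Sum>t\<in>{s'<..s}. real (s choose t) * (b / (p / real q)) ^ t)"
    using pq by (intro add_left_mono sum_mono bin_exp_frag_weight[OF V _ _ b sys])
  finally show ?thesis by (simp add: algebra_simps)
qed

text \<open>Every member is empty, so a single surviving index guarantees success; the deficit is
  then nonnegative by the spread condition at the empty set. With no index left, the deficit is
  one.\<close>

lemma col_exp_fail_size0:
  assumes X: "finite X" and q: "q \<ge> 1" and p: "0 \<le> p" "p \<le> 1"
    and sys: "spread_system (X \<times> {1..q}) 0 b I S u"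
  shows "col_exp q p X (fail I S) \<le> 1 - (\<Sum>i\<in>I. u i)"
proof (cases "I = {}")
  case True
  then have "fail I S = (\<lambda>_. 1)" by (auto simp: fail_def)
  with True show ?thesis using X q by (simp add: col_exp_const)
next
  case False
  have "S i = {}" if "i \<in> I" for i
  proof -
    have "S i \<subseteq> X \<times> {1..q}" "card (S i) = 0" using sys that by (auto simp: spread_system_def)
    then show ?thesis using X by (metis card_eq_0_iff finite_SigmaI finite_atLeastAtMost finite_subset)
  qed
  then have "fail I S = (\<lambda>_. 0)" using False by (auto simp: fail_def)
  moreover have "(\<Sum>i | i \<in> I \<and> {} \<subseteq> S i. u i) \<le> b ^ card ({} :: ('a \<times> nat) set)"
    using sys unfolding spread_system_def by blast
  ultimately show ?thesis using X q by (simp add: col_exp_const)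
qed

text \<open>Halving from \<open>2 * n\<close> to \<open>n\<close> costs at most
  \<open>4 ^ n * (1 / 16) ^ n\<close>, since there are at most \<open>4 ^ n\<close> binomial choices
  in total; this is where \<open>1 / 16\<close> comes from. As \<open>n\<close> never falls below
  \<open>a\<close>, each halving costs at most \<open>(1 / 4) ^ a\<close>.\<close>

lemma col_exp_fail_rounds:
  assumes X: "finite X" and q: "q \<ge> 1" and p: "0 < p0" "0 < p1" and b: "b \<ge> 0"
    and y: "b * real q / p1 \<le> 1 / 16" and a: "a \<ge> 1"
  shows "p0 + real k * p1 \<le> 1 \<Longrightarrow> spread_system (X \<times> {1..q}) (a * 2 ^ k) b I S u \<Longrightarrow>
    col_exp q (p0 + real k * p1) X (fail I S) \<le>
      real k * (1 / 4) ^ a + ((1 + b * real q / p0) ^ a - 1) + (1 - (\<Sum>i\<in>I. u i))"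
proof (induction k arbitrary: I S)
  case 0
  \<comment> \<open>The last round leads from size \<open>a\<close> to size 0: every nonempty
    fragment counts as lost, and the binomial theorem sums their bounds.\<close>
  have "col_exp q (p0 + 0) X (fail I S) \<le>
    (\<Sum>t\<in>{0<..a}. real (a choose t) * (b * real q / p0) ^ t) + 0 + (1 - (\<Sum>i\<in>I. u i))"
    using 0 X q p b by (intro col_exp_fail_step) (auto intro: order.trans[OF col_exp_fail_size0])
  moreover have "(1 + b * real q / p0) ^ a = (\<Sum>t\<le>a. real (a choose t) * (b * real q / p0) ^ t)"
    by (subst add.commute) (simp add: binomial_ring)
  moreover have "(\<Sum>t\<le>a. real (a choose t) * (b * real q / p0) ^ t) =
      1 + (\<Sum>t\<in>{0<..a}. real (a choose t) * (b * real q / p0) ^ t)"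
    by (simp add: atMost_atLeast0 sum.head)
  ultimately show ?case by simp
next
  case (Suc k)
  define n where "n = a * 2 ^ k"
  define y where "y = b * real q / p1"
  have y: "0 \<le> y" "y \<le> 1 / 16" using assms by (auto simp: y_def)
  have "p1 + (p0 + real k * p1) \<le> 1" using Suc.prems by (simp add: algebra_simps)
  moreover have "p0 + real k * p1 \<le> 1" using calculation p by linarith
  ultimately have "col_exp q (p1 + (p0 + real k * p1)) X (fail I S) \<le>
    (\<Sum>t\<in>{n<..2 * n}. real (2 * n choose t) * (b * real q / p1) ^ t) +
    (real k * (1 / 4) ^ a + ((1 + b * real q / p0) ^ a - 1)) + (1 - (\<Sum>i\<in>I. u i))"
    using Suc.prems X q p b by (intro col_exp_fail_step Suc.IH) (auto simp: n_def mult_ac)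
  moreover have "(\<Sum>t\<in>{n<..2 * n}. real (2 * n choose t) * y ^ t) \<le> (1 / 4) ^ a"
  proof -
    have "(\<Sum>t\<in>{n<..2 * n}. real (2 * n choose t) * y ^ t) \<le> (\<Sum>t\<in>{n<..2 * n}. real (2 * n choose t) * (1 / 16) ^ n)"
    proof (intro sum_mono mult_left_mono)
      fix t assume "t \<in> {n<..2 * n}"
      then have "y ^ t \<le> y ^ n" using y by (intro power_decreasing) auto
      also have "\<dots> \<le> (1 / 16) ^ n" using y by (intro power_mono) auto
      finally show "y ^ t \<le> (1 / 16) ^ n" .
    qed auto
    also have "\<dots> = real (\<Sum>t\<in>{n<..2 * n}. 2 * n choose t) * (1 / 16) ^ n"
      by (simp add: sum_distrib_right)
    also have "(\<Sum>t\<in>{n<..2 * n}. 2 * n choose t) \<le> (\<Sum>t\<le>2 * n. 2 * n choose t)"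
      by (intro sum_mono2) auto
    also have "(\<Sum>t\<le>2 * n. 2 * n choose t) = 4 ^ n"
      by (simp add: choose_row_sum power_mult)
    also have "real (4 ^ n) * (1 / 16) ^ n = (1 / 4 :: real) ^ n"
      by (simp flip: power_mult_distrib)
    also have "\<dots> \<le> (1 / 4) ^ a"
      by (intro power_decreasing) (auto simp: n_def)
    finally show ?thesis by (simp add: mult_right_mono)
  qed
  ultimately show ?case by (simp add: y_def algebra_simps)
qed

section \<open>Injective colourings and the spread of the rainbow hypergraph\<close>

definition injections :: "'a set \<Rightarrow> 'c set \<Rightarrow> ('a \<Rightarrow> 'c) set" where
  "injections e Q = {\<phi> \<in> e \<rightarrow>\<^sub>E Q. inj_on \<phi> e}"

lemma finite_injections: "finite e \<Longrightarrow> finite Q \<Longrightarrow> finite (injections e Q)"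
  by (simp add: injections_def finite_PiE)

lemma card_injections:
  assumes "finite e" "finite Q"
  shows "card (injections e Q) = (\<Prod>i<card e. card Q - i)"
  using assms
proof (induction e arbitrary: Q rule: finite_induct)
  case empty
  then show ?case by (simp add: injections_def)
next
  case (insert x e)
  have "bij_betw (\<lambda>\<phi>. (\<phi> x, restrict \<phi> e)) (injections (insert x e) Q) (SIGMA c:Q. injections e (Q - {c}))"
  proof (rule bij_betwI[where g = "\<lambda>(c, \<phi>). \<phi>(x := c)"])
    show "(\<lambda>\<phi>. (\<phi> x, restrict \<phi> e)) \<in> injections (insert x e) Q \<rightarrow> (SIGMA c:Q. injections e (Q - {c}))"
      using insert.hyps by (auto simp: injections_def inj_on_def)
    show "(\<lambda>(c, \<phi>). \<phi>(x := c)) \<in> (SIGMA c:Q. injections e (Q - {c})) \<rightarrow> injections (insert x e) Q"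
      using insert.hyps by (auto simp: injections_def inj_on_def PiE_def Pi_def extensional_def)
  next
    fix \<phi> assume "\<phi> \<in> injections (insert x e) Q"
    then show "(case (\<phi> x, restrict \<phi> e) of (c, \<phi>) \<Rightarrow> \<phi>(x := c)) = \<phi>"
      using insert.hyps by (auto simp: injections_def PiE_def extensional_def fun_eq_iff)
  next
    fix z assume "z \<in> (SIGMA c:Q. injections e (Q - {c}))"
    then show "((case z of (c, \<phi>) \<Rightarrow> \<phi>(x := c)) x, restrict (case z of (c, \<phi>) \<Rightarrow> \<phi>(x := c)) e) = z"
      using insert.hyps by (auto simp: injections_def PiE_def extensional_def fun_eq_iff)
  qed
  then have "card (injections (insert x e) Q) = card (SIGMA c:Q. injections e (Q - {c}))"
    by (rule bij_betw_same_card)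
  also have "\<dots> = (\<Sum>c\<in>Q. card (injections e (Q - {c})))"
    using insert by (intro card_SigmaI) (auto intro: finite_injections)
  also have "\<dots> = (\<Sum>c\<in>Q. \<Prod>i<card e. card Q - Suc i)"
    using insert by (intro sum.cong) auto
  also have "\<dots> = (\<Prod>i<card (insert x e). card Q - i)"
    using insert.hyps by (simp add: prod.lessThan_Suc_shift del: prod.lessThan_Suc)
  finally show ?case .
qed

text \<open>Such an injection is determined by its values off \<open>fst\<close>
  A\<open>, and there it must avoid the colours\<close>snd \<open>A\<close>.\<close>

lemma card_injections_extending:
  assumes "finite e" "finite Q" "A \<subseteq> e \<times> Q" "inj_on fst A" "inj_on snd A"
  shows "card {\<phi> \<in> injections e Q. A \<subseteq> (\<lambda>x. (x, \<phi> x)) ` e} \<le> (\<Prod>i<card e - card A. card Q - card A - i)"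
proof -
  let ?e = "e - fst ` A" and ?Q = "Q - snd ` A"
  have fin: "finite A" using assms finite_subset by blast
  have "card {\<phi> \<in> injections e Q. A \<subseteq> (\<lambda>x. (x, \<phi> x)) ` e} \<le> card (injections ?e ?Q)"
  proof (rule card_inj_on_le[where f = "\<lambda>\<phi>. restrict \<phi> ?e"])
    show "inj_on (\<lambda>\<phi>. restrict \<phi> ?e) {\<phi> \<in> injections e Q. A \<subseteq> (\<lambda>x. (x, \<phi> x)) ` e}"
    proof (rule inj_onI, rule ext)
      fix \<phi> \<psi> x
      assume \<phi>: "\<phi> \<in> {\<phi> \<in> injections e Q. A \<subseteq> (\<lambda>x. (x, \<phi> x)) ` e}"
        and \<psi>: "\<psi> \<in> {\<phi> \<in> injections e Q. A \<subseteq> (\<lambda>x. (x, \<phi> x)) ` e}"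
        and eq: "restrict \<phi> ?e = restrict \<psi> ?e"
      consider "x \<notin> e" | "x \<in> ?e" | c where "(x, c) \<in> A" by force
      then show "\<phi> x = \<psi> x"
      proof cases
        case 1 then show ?thesis using \<phi> \<psi> by (auto simp: injections_def PiE_def extensional_def)
      next
        case 2 then show ?thesis using fun_cong[OF eq, of x] by simp
      next
        case 3 then show ?thesis using \<phi> \<psi> by auto
      qed
    qed
    show "(\<lambda>\<phi>. restrict \<phi> ?e) ` {\<phi> \<in> injections e Q. A \<subseteq> (\<lambda>x. (x, \<phi> x)) ` e} \<subseteq> injections ?e ?Q"
    proof (intro image_subsetI)
      fix \<phi> assume "\<phi> \<in> {\<phi> \<in> injections e Q. A \<subseteq> (\<lambda>x. (x, \<phi> x)) ` e}"
      then have \<phi>: "\<phi> \<in> e \<rightarrow>\<^sub>E Q" "inj_on \<phi> e" and A: "A \<subseteq> (\<lambda>x. (x, \<phi> x)) ` e"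
        by (auto simp: injections_def)
      have "inj_on (restrict \<phi> ?e) ?e" using \<phi>(2) by (auto simp: inj_on_def)
      moreover
      have "\<phi> x \<notin> snd ` A" if "x \<in> ?e" for x
      proof
        assume "\<phi> x \<in> snd ` A"
        then obtain y where "(y, \<phi> x) \<in> A" by force
        with A have "y \<in> e" "\<phi> y = \<phi> x" by auto
        with \<phi>(2) that have "y = x" by (auto dest: inj_onD)
        with \<open>(y, \<phi> x) \<in> A\<close> that show False by force
      qed
      with \<phi>(1) have "restrict \<phi> ?e \<in> ?e \<rightarrow>\<^sub>E ?Q" by auto
      ultimately show "restrict \<phi> ?e \<in> injections ?e ?Q" by (simp add: injections_def)
    qed
  qed (use assms in \<open>auto intro: finite_injections\<close>)
  also have "\<dots> = (\<Prod>i<card ?e. card ?Q - i)"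
    using assms by (intro card_injections) auto
  also have "card ?e = card e - card A"
    using assms fin by (subst card_Diff_subset) (auto simp: card_image)
  also have "card ?Q = card Q - card A"
    using assms fin by (subst card_Diff_subset) (auto simp: card_image)
  finally show ?thesis .
qed

text \<open>A single term of the exponential series at \<open>s\<close>, serving as a crude Stirling
  bound.\<close>

lemma power_le_exp_fact: "real s ^ s \<le> exp (real s) * fact s"
proof -
  have "(\<Sum>n\<in>{s}. real s ^ n /\<^sub>R fact n) \<le> (\<Sum>n. real s ^ n /\<^sub>R fact n)"
    by (intro sum_le_suminf summable_exp_generic) auto
  then show ?thesis by (simp add: exp_def field_simps)
qed

text \<open>The product is \<open>s!\<close> times a binomial coefficient that is at least
  \<open>(q / s) ^ s\<close>, and \<open>s!\<close> is at least \<open>(s / e) ^ s\<close>. The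
  price of demanding distinct colours is thus one factor \<open>e\<close> per vertex.\<close>

lemma falling_product_ge:
  assumes "s \<le> q"
  shows "(real q / exp 1) ^ s \<le> real (\<Prod>i<s. q - i)"
proof (cases "s = 0")
  case False
  have "(real q / exp 1) ^ s = (real q / real s) ^ s * (real s ^ s / exp (real s))"
    using False by (simp add: power_divide flip: exp_of_nat_mult)
  also have "\<dots> \<le> real (q choose s) * fact s"
    using assms power_le_exp_fact[of s]
    by (intro mult_mono binomial_ge_n_over_k_pow_k) (auto simp: field_simps)
  also have "\<dots> = (\<Prod>i<s. real q - real i)"
    by (simp add: binomial_gbinomial gbinomial_prod_rev atLeast0LessThan)
  also have "\<dots> = real (\<Prod>i<s. q - i)"
    using assms by (simp add: of_nat_diff)
  finally show ?thesis .
qed simp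

lemma falling_product_split:
  fixes q :: nat
  assumes "s \<le> k"
  shows "(\<Prod>i<k. q - i) = (\<Prod>i<s. q - i) * (\<Prod>i<k - s. q - s - i)"
proof -
  have "(\<Prod>i<s + d. q - i) = (\<Prod>i<s. q - i) * (\<Prod>i<d. q - s - i)" for d
    by (induction d) (simp_all add: mult.assoc)
  from this[of "k - s"] show ?thesis using assms by simp
qed

definition rainbow_index :: "nat \<Rightarrow> 'a set set \<Rightarrow> ('a set \<times> ('a \<Rightarrow> nat)) set" where
  "rainbow_index q H = (SIGMA e:H. injections e {1..q})"

definition rainbow_graph :: "'a set \<times> ('a \<Rightarrow> nat) \<Rightarrow> ('a \<times> nat) set" where
  "rainbow_graph = (\<lambda>(e, \<phi>). (\<lambda>x. (x, \<phi> x)) ` e)"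

text \<open>The law of a uniform edge followed by a uniform injective colouring of it. Edges may
  differ in size and so in their number of injections; uniform weight on all pairs would not project
  to the uniform law on \<open>H\<close>, to which the spread condition refers.\<close>

definition rainbow_weight :: "nat \<Rightarrow> 'a set set \<Rightarrow> 'a set \<times> ('a \<Rightarrow> nat) \<Rightarrow> real" where
  "rainbow_weight q H = (\<lambda>(e, \<phi>). 1 / (real (card H) * real (card (injections e {1..q}))))"

text \<open>At most a fraction \<open>1 / \<kappa> ^ s\<close> of the edges contains the
  \<open>s\<close> vertices of \<open>A\<close>. In each of them the injections extending
  \<open>A\<close> form a fraction of at most \<open>1 / (q (q - 1) ... (q - s + 1))\<close>,
  because the remaining factors of the falling product cancel.\<close>

lemma rainbow_spread_system:
  assumes H: "hypergraph X H" "bounded_edges r H" "spread \<kappa> X H" and q: "r \<le> q" "q \<ge> 1" and \<kappa>: "\<kappa> > 0"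
  shows "spread_system (X \<times> {1..q}) r (exp 1 / (\<kappa> * real q)) (rainbow_index q H) rainbow_graph (rainbow_weight q H)"
    and "(\<Sum>i\<in>rainbow_index q H. rainbow_weight q H i) = 1"
proof -
  let ?I = "rainbow_index q H" and ?u = "rainbow_weight q H"
  let ?R = "\<lambda>e. injections e {1..q}"
  have X: "finite X" and H_ne: "H \<noteq> {}" and HX: "\<And>e. e \<in> H \<Longrightarrow> e \<subseteq> X"
    and Hr: "\<And>e. e \<in> H \<Longrightarrow> card e \<le> r"
    using H by (auto simp: hypergraph_def bounded_edges_def)
  have finH: "finite H" using X HX by (meson PowI finite_Pow_iff finite_subset subsetI)
  have fin_e: "finite e" if "e \<in> H" for e using HX[OF that] X finite_subset by blast
  have finR: "finite (?R e)" if "e \<in> H" for e using fin_e[OF that] by (simp add: finite_injections)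
  have finI: "finite ?I" using finH finR by (auto simp: rainbow_index_def)
  have cardR: "card (?R e) = (\<Prod>i<card e. q - i)" if "e \<in> H" for e
    using fin_e[OF that] by (simp add: card_injections)
  have cardR_pos: "0 < card (?R e)" if "e \<in> H" for e
    unfolding cardR[OF that] using Hr[OF that] q by (intro prod_pos) auto
  have cardH: "0 < card H" using finH H_ne by (simp add: card_gt_0_iff)
  have "(\<Sum>i\<in>?I. ?u i) = (\<Sum>e\<in>H. \<Sum>\<phi>\<in>?R e. 1 / (real (card H) * real (card (?R e))))"
    unfolding rainbow_index_def rainbow_weight_def using finH finR by (subst sum.Sigma) auto
  also have "\<dots> = (\<Sum>e\<in>H. 1 / real (card H))"
    using cardR_pos by (intro sum.cong) (auto simp: field_simps)
  finally show "(\<Sum>i\<in>?I. ?u i) = 1" using cardH by simp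
  show "spread_system (X \<times> {1..q}) r (exp 1 / (\<kappa> * real q)) ?I rainbow_graph ?u"
    unfolding spread_system_def
  proof (intro conjI ballI allI impI finI)
    fix i assume "i \<in> ?I"
    then obtain e \<phi> where i: "i = (e, \<phi>)" "e \<in> H" "\<phi> \<in> ?R e" by (auto simp: rainbow_index_def)
    show "0 \<le> ?u i" by (simp add: i rainbow_weight_def)
    show "rainbow_graph i \<subseteq> X \<times> {1..q}" "inj_on fst (rainbow_graph i)"
      using i(2,3) HX[OF i(2)] by (auto simp: i(1) rainbow_graph_def injections_def inj_on_def)
    show "card (rainbow_graph i) \<le> r"
      using card_image_le[OF fin_e[OF i(2)], of "\<lambda>x. (x, \<phi> x)"] Hr[OF i(2)] by (simp add: i(1) rainbow_graph_def)
  next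
    fix A assume A: "A \<subseteq> X \<times> {1..q}"
    define s where "s = card A"
    show "(\<Sum>i | i \<in> ?I \<and> A \<subseteq> rainbow_graph i. ?u i) \<le> (exp 1 / (\<kappa> * real q)) ^ card A"
    \<comment> \<open>If no member contains \<open>A\<close>, the sum is empty. Otherwise
      \<open>A\<close> is a partial injection, so it has \<open>s\<close> distinct vertices and
      \<open>s\<close> distinct colours, and \<open>s\<close> is at most \<open>q\<close>.\<close>
    proof (cases "\<exists>i\<in>?I. A \<subseteq> rainbow_graph i")
      case False
      then have none: "{i. i \<in> ?I \<and> A \<subseteq> rainbow_graph i} = {}" by blast
      show ?thesis unfolding none using \<kappa> by simp
    next
      case True
      then obtain e \<phi> where e: "e \<in> H" "\<phi> \<in> ?R e" "A \<subseteq> (\<lambda>x. (x, \<phi> x)) ` e"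
        by (auto simp: rainbow_index_def rainbow_graph_def)
      have "inj_on \<phi> e" using e(2) by (simp add: injections_def)
      then have "inj_on fst ((\<lambda>x. (x, \<phi> x)) ` e)" "inj_on snd ((\<lambda>x. (x, \<phi> x)) ` e)"
        by (auto simp: inj_on_def)
      then have injA: "inj_on fst A" "inj_on snd A"
        using e(3) by (auto intro: inj_on_subset)
      have "s \<le> card ((\<lambda>x. (x, \<phi> x)) ` e)"
        unfolding s_def using e(3) fin_e[OF e(1)] by (intro card_mono) auto
      also have "\<dots> \<le> card e" by (rule card_image_le[OF fin_e[OF e(1)]])
      finally have "s \<le> card e" .
      then have sq: "s \<le> q" using Hr[OF e(1)] q by linarith
      have card_fst: "card (fst ` A) = s" using injA by (simp add: s_def card_image)
      have fst_X: "fst ` A \<subseteq> X" using A by auto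
      let ?R' = "\<lambda>e. {\<phi> \<in> ?R e. A \<subseteq> (\<lambda>x. (x, \<phi> x)) ` e}"
      let ?H' = "H \<inter> up_set X (fst ` A)"
      have "{i. i \<in> ?I \<and> A \<subseteq> rainbow_graph i} = (SIGMA e:?H'. ?R' e)"
        unfolding rainbow_index_def rainbow_graph_def up_set_def using HX by auto
      then have "(\<Sum>i | i \<in> ?I \<and> A \<subseteq> rainbow_graph i. ?u i) =
          (\<Sum>e\<in>?H'. \<Sum>\<phi>\<in>?R' e. 1 / (real (card H) * real (card (?R e))))"
        unfolding rainbow_weight_def using finH finR by (subst sum.Sigma) auto
      also have "\<dots> \<le> (\<Sum>e\<in>?H'. 1 / real (card H) * (exp 1 / real q) ^ s)"
      proof (rule sum_mono)
        fix e assume e: "e \<in> ?H'"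
        then have eH: "e \<in> H" and eA: "fst ` A \<subseteq> e" by (auto simp: up_set_def)
        have s_le: "s \<le> card e"
          using card_mono[OF fin_e[OF eH] eA] by (simp add: card_fst)
        have "A \<subseteq> e \<times> {1..q}" using A eA by force
        then have R': "card (?R' e) \<le> (\<Prod>i<card e - s. q - s - i)"
          using card_injections_extending[OF fin_e[OF eH], of "{1..q}" A] injA by (simp add: s_def)
        have R: "card (?R e) = (\<Prod>i<s. q - i) * (\<Prod>i<card e - s. q - s - i)"
          unfolding cardR[OF eH] by (rule falling_product_split[OF s_le])
        have "(real q / exp 1) ^ s * real (card (?R' e)) \<le> real (card (?R e))"
          unfolding R of_nat_mult
          by (intro mult_mono falling_product_ge[OF sq] of_nat_mono[OF R']) (rule of_nat_0_le_iff)+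
        moreover have inv: "(exp 1 / real q) ^ s = 1 / (real q / exp 1) ^ s"
          by (simp add: power_divide)
        ultimately have "real (card (?R' e)) / real (card (?R e)) \<le> (exp 1 / real q) ^ s"
          unfolding inv using cardR_pos[OF eH] q by (simp add: pos_divide_le_eq pos_le_divide_eq mult.commute)
        then have "1 / real (card H) * (real (card (?R' e)) / real (card (?R e))) \<le>
            1 / real (card H) * (exp 1 / real q) ^ s"
          by (intro mult_left_mono) auto
        then show "(\<Sum>\<phi>\<in>?R' e. 1 / (real (card H) * real (card (?R e)))) \<le>
            1 / real (card H) * (exp 1 / real q) ^ s"
          by simp
      qed
      also have "\<dots> = real (card ?H') / real (card H) * (exp 1 / real q) ^ s"
        by simp
      also have "\<dots> \<le> (1 / \<kappa> ^ s) * (exp 1 / real q) ^ s"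
      proof (intro mult_right_mono)
        have "real (card ?H') \<le> real (card H) / \<kappa> ^ s"
          using H(3) fst_X card_fst unfolding spread_def by blast
        then show "real (card ?H') / real (card H) \<le> 1 / \<kappa> ^ s"
          using cardH by (simp add: pos_divide_le_eq)
      qed simp
      also have "\<dots> = (exp 1 / (\<kappa> * real q)) ^ card A"
        by (simp add: s_def power_divide power_mult_distrib)
      finally show ?thesis .
    qed
  qed
qed

section \<open>From binomial subsets to subsets of fixed size\<close>

text \<open>Double counting of the pairs \<open>(Y, y)\<close> with \<open>y \<in> Y\<close>:
  deleting \<open>y\<close> does not decrease \<open>F\<close>, and each \<open>j\<close>-set arises
  from \<open>card X - j\<close> pairs.\<close>

lemma antimono_layer_step:
  fixes F :: "'a set \<Rightarrow> real"
  assumes X: "finite X" and anti: "\<And>Y x. Y \<subseteq> X \<Longrightarrow> x \<in> X \<Longrightarrow> F (insert x Y) \<le> F Y"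
  shows "real (Suc j) * (\<Sum>Y | Y \<subseteq> X \<and> card Y = Suc j. F Y) \<le>
    real (card X - j) * (\<Sum>Y | Y \<subseteq> X \<and> card Y = j. F Y)"
proof -
  define layer where "layer k = {Y. Y \<subseteq> X \<and> card Y = k}" for k
  have fin_layer: "finite (layer k)" for k
    using X by (auto simp: layer_def intro: finite_subset[of _ "Pow X"])
  have fin: "finite Y" if "Y \<subseteq> X" for Y
    using that X by (rule finite_subset)
  have "real (Suc j) * (\<Sum>Y\<in>layer (Suc j). F Y) = (\<Sum>Y\<in>layer (Suc j). \<Sum>y\<in>Y. F Y)"
    unfolding sum_distrib_left by (intro sum.cong) (auto simp: layer_def)
  also have "\<dots> \<le> (\<Sum>Y\<in>layer (Suc j). \<Sum>y\<in>Y. F (Y - {y}))"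
  proof (intro sum_mono)
    fix Y y assume Y: "Y \<in> layer (Suc j)" "y \<in> Y"
    then have "insert y (Y - {y}) = Y" "Y - {y} \<subseteq> X" "y \<in> X" by (auto simp: layer_def)
    then show "F Y \<le> F (Y - {y})" using anti[of "Y - {y}" y] by simp
  qed
  also have "\<dots> = (\<Sum>(Y, y)\<in>(SIGMA Y:layer (Suc j). Y). F (Y - {y}))"
    using fin_layer fin by (intro sum.Sigma) (auto simp: layer_def)
  also have "\<dots> = (\<Sum>(Z, y)\<in>(SIGMA Z:layer j. X - Z). F Z)"
  proof (rule sum.reindex_bij_witness[of _ "\<lambda>(Z, y). (insert y Z, y)" "\<lambda>(Y, y). (Y - {y}, y)"])
    fix z assume "z \<in> (SIGMA Z:layer j. X - Z)"
    then show "(case z of (Z, y) \<Rightarrow> (insert y Z, y)) \<in> (SIGMA Y:layer (Suc j). Y)"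
      using fin by (auto simp: layer_def)
  qed (use fin in \<open>auto simp: layer_def\<close>)
  also have "\<dots> = (\<Sum>Z\<in>layer j. \<Sum>y\<in>X - Z. F Z)"
    using fin_layer X by (intro sum.Sigma[symmetric]) auto
  also have "\<dots> = real (card X - j) * (\<Sum>Z\<in>layer j. F Z)"
    unfolding sum_distrib_left
    using fin by (intro sum.cong) (auto simp: layer_def card_Diff_subset)
  finally show ?thesis by (simp add: layer_def)
qed

lemma antimono_layer_average:
  fixes F :: "'a set \<Rightarrow> real"
  assumes X: "finite X" and anti: "\<And>Y x. Y \<subseteq> X \<Longrightarrow> x \<in> X \<Longrightarrow> F (insert x Y) \<le> F Y"
    and "j \<le> m" "m \<le> card X"
  shows "(\<Sum>Y | Y \<subseteq> X \<and> card Y = m. F Y) / real (card X choose m) \<le>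
    (\<Sum>Y | Y \<subseteq> X \<and> card Y = j. F Y) / real (card X choose j)"
  using assms(3,4)
proof (induction m rule: dec_induct)
  case (step n)
  let ?L = "\<lambda>k. \<Sum>Y | Y \<subseteq> X \<and> card Y = k. F Y"
  have pos: "0 < real (card X choose n)" "0 < real (card X choose Suc n)" "0 < real (card X - n)"
    using step.prems by auto
  have absorb: "Suc n * (card X choose Suc n) = (card X - n) * (card X choose n)"
    using binomial_absorption[of n "card X"] binomial_absorb_comp[of "card X" n] by simp
  have "?L (Suc n) / real (card X choose Suc n) = real (Suc n) * ?L (Suc n) / real (Suc n * (card X choose Suc n))"
    unfolding of_nat_mult by (rule mult_divide_mult_cancel_left[symmetric]) simp
  also have "\<dots> \<le> real (card X - n) * ?L n / real (Suc n * (card X choose Suc n))"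
    using antimono_layer_step[OF X anti, of n] by (intro divide_right_mono) auto
  also have "\<dots> = ?L n / real (card X choose n)"
    unfolding absorb using pos by simp
  also have "\<dots> \<le> ?L j / real (card X choose j)"
    using step.IH step.prems by simp
  finally show ?case .
qed simp

text \<open>Markov's inequality suffices here: at half the density, the binomial set has at most m
  elements with probability at least one half.\<close>

lemma uniform_average_le_bin_exp:
  fixes F :: "'a set \<Rightarrow> real"
  assumes X: "finite X" and anti: "\<And>Y x. Y \<subseteq> X \<Longrightarrow> x \<in> X \<Longrightarrow> F (insert x Y) \<le> F Y"
    and nonneg: "\<And>Y. 0 \<le> F Y" and m: "0 < m" "m \<le> card X"
  shows "(\<Sum>Y | Y \<subseteq> X \<and> card Y = m. F Y) / real (card X choose m) \<le>
    2 * bin_exp (real m / (2 * real (card X))) X F"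
proof -
  define p where "p = real m / (2 * real (card X))"
  define M where "M = (\<Sum>Y | Y \<subseteq> X \<and> card Y = m. F Y) / real (card X choose m)"
  have p: "0 \<le> p" "p \<le> 1" using m by (auto simp: p_def divide_le_eq)
  have M: "0 \<le> M" unfolding M_def using nonneg by (intro divide_nonneg_nonneg sum_nonneg) auto
  let ?small = "\<lambda>Y. of_bool (card Y \<le> m) :: real"
  \<comment> \<open>Layers up to \<open>m\<close> have average at least \<open>M\<close>, so within
    each of them \<open>F - M\<close> sums to a nonnegative number.\<close>
  have "0 \<le> (\<Sum>j\<le>m. \<Sum>Y | Y \<in> {Y. Y \<subseteq> X \<and> card Y \<le> m} \<and> card Y = j. p ^ card Y * (1 - p) ^ card (X - Y) * (F Y - M))"
  proof (rule sum_nonneg)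
    fix j assume "j \<in> {..m}"
    then have j: "j \<le> m" by simp
    have "(\<Sum>Y | Y \<in> {Y. Y \<subseteq> X \<and> card Y \<le> m} \<and> card Y = j. p ^ card Y * (1 - p) ^ card (X - Y) * (F Y - M)) =
        (\<Sum>Y | Y \<subseteq> X \<and> card Y = j. p ^ j * (1 - p) ^ (card X - j) * (F Y - M))"
      using X j by (intro sum.cong) (auto simp: card_Diff_subset finite_subset)
    also have "\<dots> = p ^ j * (1 - p) ^ (card X - j) *
        ((\<Sum>Y | Y \<subseteq> X \<and> card Y = j. F Y) - real (card X choose j) * M)"
      by (simp add: sum_distrib_left[symmetric] sum_subtractf n_subsets[OF X])
    also have "\<dots> \<ge> 0"
    proof -
      have "0 < real (card X choose j)" using j m by simp
      then have "real (card X choose j) * M \<le> (\<Sum>Y | Y \<subseteq> X \<and> card Y = j. F Y)"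
        using antimono_layer_average[OF X anti j m(2)]
        unfolding M_def by (simp only: pos_le_divide_eq mult.commute)
      then show ?thesis using p by simp
    qed
    finally show "0 \<le> (\<Sum>Y | Y \<in> {Y. Y \<subseteq> X \<and> card Y \<le> m} \<and> card Y = j.
        p ^ card Y * (1 - p) ^ card (X - Y) * (F Y - M))" .
  qed
  also have "\<dots> = (\<Sum>Y | Y \<subseteq> X \<and> card Y \<le> m. p ^ card Y * (1 - p) ^ card (X - Y) * (F Y - M))"
    using X by (intro sum.group) (auto intro: finite_subset[of _ "Pow X"])
  also have "\<dots> = bin_exp p X (\<lambda>Y. ?small Y * (F Y - M))"
    unfolding bin_exp_def using X by (intro sum.mono_neutral_cong_left) auto
  finally have layers: "0 \<le> bin_exp p X (\<lambda>Y. ?small Y * (F Y - M))" .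
  \<comment> \<open>The function \<open>1 - card Y / m\<close> has expectation one half at this
    density and lies below the indicator of \<open>card Y \<le> m\<close>.\<close>
  have "M / 2 = M * bin_exp p X (\<lambda>Y. 1 + (-1) * (\<Sum>v\<in>Y. 1 / real m))"
    unfolding bin_exp_add bin_exp_cmult bin_exp_weight_sum[OF X] bin_exp_const[OF X]
    using m by (simp add: p_def)
  also have "\<dots> \<le> M * bin_exp p X ?small"
    using M p m by (intro mult_left_mono bin_exp_mono) (auto simp: of_bool_def field_simps)
  also have "\<dots> \<le> M * bin_exp p X ?small + bin_exp p X (\<lambda>Y. ?small Y * (F Y - M))"
    using layers by simp
  also have "\<dots> = bin_exp p X (\<lambda>Y. ?small Y * F Y)"
    unfolding bin_exp_cmult[symmetric] bin_exp_add[symmetric] by (simp add: algebra_simps)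
  also have "\<dots> \<le> bin_exp p X F"
    using p nonneg by (intro bin_exp_mono) (auto simp: of_bool_def)
  finally show ?thesis by (simp add: M_def p_def)
qed

section \<open>The probability of a rainbow edge\<close>

lemma pair_pmf_of_set:
  assumes "finite A" "A \<noteq> {}" "finite B" "B \<noteq> {}"
  shows "pair_pmf (pmf_of_set A) (pmf_of_set B) = pmf_of_set (A \<times> B)"
proof (rule pmf_eqI)
  fix z :: "'a \<times> 'b"
  obtain x y where z: "z = (x, y)" by fastforce
  have "pmf (pmf_of_set (A \<times> B)) z = indicator (A \<times> B) z / real (card (A \<times> B))"
    using assms by (intro pmf_of_set) auto
  then show "pmf (pair_pmf (pmf_of_set A) (pmf_of_set B)) z = pmf (pmf_of_set (A \<times> B)) z"
    using assms by (simp add: z pmf_pair pmf_of_set card_cartesian_product indicator_times)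
qed

text \<open>A function on \<open>e\<close> whose graph lies in the graph of \<open>c\<close> is the
  restriction of \<open>c\<close> to \<open>e\<close>, so its injectivity says that \<open>c\<close>
  is rainbow on \<open>e\<close>.\<close>

lemma fail_rainbow_graph:
  assumes "c \<in> PiE_dflt X 0 (\<lambda>_. {1..q})" "Y \<subseteq> X"
  shows "fail (rainbow_index q H) rainbow_graph ((\<lambda>x. (x, c x)) ` Y) =
    1 - of_bool (\<exists>e\<in>H. e \<subseteq> Y \<and> rainbow c e)"
proof -
  have "(\<exists>i\<in>rainbow_index q H. rainbow_graph i \<subseteq> (\<lambda>x. (x, c x)) ` Y) \<longleftrightarrow> (\<exists>e\<in>H. e \<subseteq> Y \<and> rainbow c e)"
  proof
    assume "\<exists>i\<in>rainbow_index q H. rainbow_graph i \<subseteq> (\<lambda>x. (x, c x)) ` Y"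
    then obtain e \<phi> where e: "e \<in> H" "inj_on \<phi> e" "(\<lambda>x. (x, \<phi> x)) ` e \<subseteq> (\<lambda>x. (x, c x)) ` Y"
      by (auto simp: rainbow_index_def rainbow_graph_def injections_def)
    then have "e \<subseteq> Y" "\<And>x. x \<in> e \<Longrightarrow> \<phi> x = c x" by auto
    with e show "\<exists>e\<in>H. e \<subseteq> Y \<and> rainbow c e"
      unfolding rainbow_def by (metis inj_on_cong)
  next
    assume "\<exists>e\<in>H. e \<subseteq> Y \<and> rainbow c e"
    then obtain e where e: "e \<in> H" "e \<subseteq> Y" "inj_on c e" by (auto simp: rainbow_def)
    have "c x \<in> {1..q}" if "x \<in> e" for x
      using assms e(2) that by (auto simp: PiE_dflt_def)
    then have "(e, restrict c e) \<in> rainbow_index q H"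
      using e by (auto simp: rainbow_index_def injections_def inj_on_def)
    moreover have "rainbow_graph (e, restrict c e) \<subseteq> (\<lambda>x. (x, c x)) ` Y"
      using e(2) by (auto simp: rainbow_graph_def)
    ultimately show "\<exists>i\<in>rainbow_index q H. rainbow_graph i \<subseteq> (\<lambda>x. (x, c x)) ` Y" by blast
  qed
  then show ?thesis by (simp add: fail_def)
qed

lemma prob_rainbow_edge_eq:
  assumes X: "finite X" and m: "m \<le> card X" and q: "q \<ge> 1"
  shows "prob_rainbow_edge X H q m = 1 -
    (\<Sum>Y | Y \<subseteq> X \<and> card Y = m. (\<Sum>c\<in>PiE_dflt X 0 (\<lambda>_. {1..q}).
      fail (rainbow_index q H) rainbow_graph ((\<lambda>x. (x, c x)) ` Y)) / real (q ^ card X)) / real (card X choose m)"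
proof -
  define A where "A = {Y. Y \<subseteq> X \<and> card Y = m}"
  define B where "B = PiE_dflt X (0 :: nat) (\<lambda>_. {1..q})"
  define G where "G = {(Y, c). \<exists>e\<in>H. e \<subseteq> Y \<and> rainbow c e}"
  have A: "finite A" "card A = (card X choose m)"
    using X by (auto simp: A_def n_subsets intro: finite_subset[of _ "Pow X"])
  have B: "finite B" "card B = q ^ card X"
    unfolding B_def by (simp_all add: X finite_PiE_dflt card_PiE_dflt)
  have pos: "0 < real (card A)" "0 < real (card B)"
    using m q by (simp_all add: A B)
  then have ne: "A \<noteq> {}" "B \<noteq> {}" by auto
  have "random_coloring X q = pmf_of_set B"
    unfolding random_coloring_def B_def using X q by (intro Pi_pmf_of_set) auto
  then have "prob_rainbow_edge X H q m = real (card (A \<times> B \<inter> G)) / real (card (A \<times> B))"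
    unfolding prob_rainbow_edge_def random_subset_def using A B ne
    by (simp add: pair_pmf_of_set measure_pmf_of_set G_def flip: A_def)
  also have "real (card (A \<times> B \<inter> G)) = (\<Sum>z\<in>A \<times> B. of_bool (z \<in> G))"
    using A B by (simp add: of_bool_def sum.If_cases Int_def)
  also have "\<dots> = (\<Sum>Y\<in>A. \<Sum>c\<in>B. of_bool (\<exists>e\<in>H. e \<subseteq> Y \<and> rainbow c e))"
    by (simp add: G_def sum.cartesian_product case_prod_unfold)
  also have "\<dots> = (\<Sum>Y\<in>A. \<Sum>c\<in>B. 1 - fail (rainbow_index q H) rainbow_graph ((\<lambda>x. (x, c x)) ` Y))"
    by (intro sum.cong) (auto simp: fail_rainbow_graph A_def B_def)
  also have "\<dots> = real (card A) * real (card B) -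
      (\<Sum>Y\<in>A. \<Sum>c\<in>B. fail (rainbow_index q H) rainbow_graph ((\<lambda>x. (x, c x)) ` Y))"
    by (simp add: sum_subtractf)
  also have "\<dots> / real (card (A \<times> B)) = 1 -
      (\<Sum>Y\<in>A. (\<Sum>c\<in>B. fail (rainbow_index q H) rainbow_graph ((\<lambda>x. (x, c x)) ` Y)) / real (card B)) / real (card A)"
    using pos by (simp add: card_cartesian_product diff_divide_distrib sum_divide_distrib mult.commute)
  finally show ?thesis by (simp only: A B A_def[symmetric] B_def[symmetric])
qed

lemma prob_rainbow_edge_ge_col_exp:
  assumes X: "finite X" and m: "0 < m" "m \<le> card X" and q: "q \<ge> 1"
  shows "prob_rainbow_edge X H q m \<ge> 1 -
    2 * col_exp q (real m / (2 * real (card X))) X (fail (rainbow_index q H) rainbow_graph)"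
proof -
  have "fail I S (insert v W) \<le> fail I S W" for I :: "('a set \<times> ('a \<Rightarrow> nat)) set" and S W and v :: "'a \<times> nat"
    by (auto simp: fail_def)
  then have "(\<Sum>Y | Y \<subseteq> X \<and> card Y = m. (\<Sum>c\<in>PiE_dflt X 0 (\<lambda>_. {1..q}).
      fail (rainbow_index q H) rainbow_graph ((\<lambda>x. (x, c x)) ` Y)) / real (q ^ card X)) / real (card X choose m) \<le>
    2 * col_exp q (real m / (2 * real (card X))) X (fail (rainbow_index q H) rainbow_graph)"
    unfolding col_exp_def using X m
    by (intro uniform_average_le_bin_exp divide_right_mono sum_mono divide_nonneg_nonneg sum_nonneg)
      (auto simp: fail_def)
  then show ?thesis using prob_rainbow_edge_eq[OF X m(2) q, of H] by linarith
qed

section \<open>Choice of parameters and the limit\<close>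

lemma prob_rainbow_edge_ge:
  fixes \<kappa> :: real and r :: nat
  defines "l \<equiv> log 2 (real r)"
  assumes H: "hypergraph X H" "bounded_edges r H" "spread \<kappa> X H" and q: "r \<le> q" and r: "2 \<le> r"
    and \<kappa>: "0 < \<kappa>" and m: "m \<le> card X" "400 * l * real (card X) / \<kappa> \<le> real m"
  shows "prob_rainbow_edge X H q m \<ge> 1 - 2 * (1 / l + (exp ((log 2 (l + 1) + 2) / l) - 1))"
proof (cases "X = {}")
  \<comment> \<open>Treated apart because the density below divides by
    \<open>card X\<close>.\<close>
  case True
  then have "H = {{}}" using H(1) by (auto simp: hypergraph_def)
  then have "prob_rainbow_edge X H q m = 1"
    by (simp add: prob_rainbow_edge_def rainbow_def case_prod_unfold)
  moreover have "1 \<le> l" using r by (simp add: l_def le_log_iff)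
  moreover from this have "0 \<le> 1 / l" "1 \<le> exp ((log 2 (l + 1) + 2) / l)" by simp_all
  moreover have "1 - 2 * (u + (v - 1)) \<le> 1" if "0 \<le> u" "1 \<le> v" for u v :: real
    using that by simp
  ultimately show ?thesis by metis
next
  case False
  have X: "finite X" using H(1) by (simp add: hypergraph_def)
  have N: "0 < real (card X)" using X False by (simp add: card_gt_0_iff)
  have l: "1 \<le> l" using r by (simp add: l_def le_log_iff)
  have "0 < 400 * l * real (card X) / \<kappa>" using l N \<kappa> by simp
  then have m0: "0 < m" using m(2) by (cases m) auto
  \<comment> \<open>The number \<open>n\<close> of halvings is large enough for
    \<open>r \<le> 2 ^ n\<close>, and \<open>a\<close> for \<open>n \<le> 2 ^ a\<close>. The
    \<open>+ 1\<close> keeps \<open>a\<close> positive when \<open>n = 1\<close>.\<close>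
  define n where "n = nat \<lceil>l\<rceil>"
  define a where "a = nat \<lceil>log 2 (real n)\<rceil> + 1"
  have n: "l \<le> real n" "real n \<le> l + 1" "1 \<le> real n" using l unfolding n_def by linarith+
  have log_n: "0 \<le> log 2 (real n)" using n by simp
  have a: "log 2 (real n) \<le> real a" "real a \<le> log 2 (real n) + 2" using log_n unfolding a_def by linarith+
  define p where "p = real m / (2 * real (card X))"
  \<comment> \<open>Half of the density goes to the last round, half is shared by the
    \<open>n\<close> halvings. The constant 400 pays a factor 2 for \<open>p\<close> and a factor 2
    for this division; with \<open>n \<le> 2 * l\<close> and \<open>e \<le> 3\<close> the halvings
    have ratio at most \<open>12 / 200\<close>, just below \<open>1 / 16\<close>.\<close>
  define p0 where "p0 = p / 2"
  define p1 where "p1 = p / (2 * real n)"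
  define b where "b = exp 1 / (\<kappa> * real q)"
  have p: "0 < p" "p \<le> 1" using m0 m N by (auto simp: p_def divide_le_eq)
  have p01: "0 < p0" "0 < p1" "p0 + real n * p1 = p" using p n by (auto simp: p0_def p1_def)
  have b: "0 \<le> b" using \<kappa> by (simp add: b_def)
  have pk: "200 * l \<le> p * \<kappa>" using m(2) N \<kappa> by (simp add: p_def field_simps)
  have e3: "exp 1 \<le> (3 :: real)" by (rule exp_le)
  have y0: "b * real q / p0 \<le> 1 / l"
  proof -
    have "b * real q / p0 = 2 * exp 1 / (p * \<kappa>)" using q r p by (simp add: b_def p0_def mult_ac)
    also have "\<dots> \<le> 2 * exp 1 / (200 * l)"
      using pk l p(1) \<kappa> by (intro divide_left_mono mult_pos_pos) auto
    also have "\<dots> \<le> 1 / l" using e3 l by (simp add: divide_le_eq)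
    finally show ?thesis .
  qed
  have y1: "b * real q / p1 \<le> 1 / 16"
  proof -
    have "b * real q / p1 = 2 * real n * exp 1 / (p * \<kappa>)" using q r p by (simp add: b_def p1_def mult_ac)
    also have "\<dots> \<le> 2 * real n * exp 1 / (200 * l)"
      using pk l p(1) \<kappa> by (intro divide_left_mono mult_pos_pos) auto
    also have "\<dots> \<le> 2 * (2 * l) * 3 / (200 * l)"
      using n l e3 by (intro divide_right_mono mult_mono) auto
    also have "\<dots> \<le> 1 / 16" using l by simp
    finally show ?thesis .
  qed
  have "r \<le> a * 2 ^ n"
  proof -
    have "real r = 2 powr l" using r by (simp add: l_def)
    also have "\<dots> \<le> 2 powr real n" using n by simp
    also have "\<dots> = real (2 ^ n)" by (simp add: powr_realpow)
    finally have "r \<le> 2 ^ n" by (simp only: of_nat_le_iff)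
    also have "\<dots> \<le> a * 2 ^ n" by (simp add: a_def)
    finally show ?thesis .
  qed
  with rainbow_spread_system(1)[OF H q _ \<kappa>] q r
  have sys: "spread_system (X \<times> {1..q}) (a * 2 ^ n) b (rainbow_index q H) rainbow_graph (rainbow_weight q H)"
    unfolding b_def spread_system_def by (auto intro: order.trans)
  have total: "(\<Sum>i\<in>rainbow_index q H. rainbow_weight q H i) = 1"
    using rainbow_spread_system(2)[OF H q _ \<kappa>] q r by simp
  have "col_exp q p X (fail (rainbow_index q H) rainbow_graph) \<le>
      real n * (1 / 4) ^ a + ((1 + b * real q / p0) ^ a - 1)"
    using col_exp_fail_rounds[OF X _ p01(1,2) b y1 _ _ sys] p01(3) p q r total by (simp add: a_def)
  also have "real n * (1 / 4) ^ a \<le> 1 / l"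
  proof -
    have "real n = 2 powr log 2 (real n)" using n by simp
    also have "\<dots> \<le> 2 powr real a" using a by simp
    also have "\<dots> = 2 ^ a" by (simp add: powr_realpow)
    finally have "real n \<le> 2 ^ a" .
    \<comment> \<open>Both \<open>n\<close> and \<open>l\<close> are at most \<open>2 ^ a\<close>,
      so \<open>n\<close> errors of size \<open>(1 / 4) ^ a\<close> add up to at most
      \<open>1 / l\<close>.\<close>
    then have "real n * l \<le> 2 ^ a * 2 ^ a" using n(1) l by (intro mult_mono order.trans[OF n(1)]) simp_all
    also have "\<dots> = 4 ^ a" by (simp flip: power_mult_distrib)
    finally have "real n * l \<le> 4 ^ a" .
    then show ?thesis using l by (simp add: power_divide pos_divide_le_eq pos_le_divide_eq)
  qed
  also have "(1 + b * real q / p0) ^ a \<le> exp ((log 2 (l + 1) + 2) / l)"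
  proof -
    have "(1 + b * real q / p0) ^ a \<le> exp (1 / l) ^ a"
      using b p01 y0 by (intro power_mono order.trans[OF exp_ge_add_one_self]) (auto simp: add_nonneg_nonneg)
    also have "\<dots> = exp (real a * (1 / l))" by (simp only: exp_of_nat_mult)
    also have "real a * (1 / l) \<le> (log 2 (l + 1) + 2) / l"
    proof -
      have "log 2 (real n) \<le> log 2 (l + 1)" using n l by simp
      then show ?thesis using a l by (simp add: divide_right_mono)
    qed
    finally show ?thesis by simp
  qed
  finally have "col_exp q p X (fail (rainbow_index q H) rainbow_graph) \<le>
      1 / l + (exp ((log 2 (l + 1) + 2) / l) - 1)" by simp
  then show ?thesis
    using prob_rainbow_edge_ge_col_exp[OF X m0 m(1), of q H] q r by (simp add: p_def)
qed

theorem theorem2: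
  fixes L :: real
  assumes "L > 0"
  shows "\<exists>C::real. C > 0 \<and>
    (\<forall>(X :: nat \<Rightarrow> 'a set) (H :: nat \<Rightarrow> 'a set set) (\<kappa> :: nat \<Rightarrow> real)
       (q :: nat \<Rightarrow> nat) (m :: nat \<Rightarrow> nat).
      (\<forall>\<^sub>F r in sequentially.
         hypergraph (X r) (H r) \<and>
         bounded_edges r (H r) \<and>
         spread (\<kappa> r) (X r) (H r) \<and>
         q r \<ge> r \<and>
         \<kappa> r \<ge> L * real r \<and>
         real (card (X r)) \<le> (\<kappa> r)\<^sup>2 * real r / (ln (real r)) ^ 5 \<and>
         m r \<le> card (X r) \<and>
         real (m r) \<ge> (C * log 2 (real r)) * real (card (X r)) / \<kappa> r)
      \<longrightarrow> (\<lambda>r. prob_rainbow_edge (X r) (H r) (q r) (m r)) \<longlonglongrightarrow> 1)"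
proof (intro exI[of _ 400] conjI allI impI)
  fix X :: "nat \<Rightarrow> 'a set" and H :: "nat \<Rightarrow> 'a set set" and \<kappa> :: "nat \<Rightarrow> real" and q m :: "nat \<Rightarrow> nat"
  let ?P = "\<lambda>r. prob_rainbow_edge (X r) (H r) (q r) (m r)"
  let ?l = "\<lambda>r. log 2 (real r)"
  let ?f = "\<lambda>r. 1 - 2 * (1 / ?l r + (exp ((log 2 (?l r + 1) + 2) / ?l r) - 1))"
  assume "\<forall>\<^sub>F r in sequentially.
         hypergraph (X r) (H r) \<and>
         bounded_edges r (H r) \<and>
         spread (\<kappa> r) (X r) (H r) \<and>
         q r \<ge> r \<and>
         \<kappa> r \<ge> L * real r \<and>
         real (card (X r)) \<le> (\<kappa> r)\<^sup>2 * real r / (ln (real r)) ^ 5 \<and>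
         m r \<le> card (X r) \<and>
         real (m r) \<ge> (400 * log 2 (real r)) * real (card (X r)) / \<kappa> r"
  with eventually_ge_at_top[of 2] have lower: "\<forall>\<^sub>F r in sequentially. ?f r \<le> ?P r"
  proof eventually_elim
    case (elim r)
    then have "0 < L * real r" using assms by simp
    with elim show ?case by (intro prob_rainbow_edge_ge[where \<kappa> = "\<kappa> r"]) auto
  qed
  have upper: "\<forall>\<^sub>F r in sequentially. ?P r \<le> 1"
    by (simp add: prob_rainbow_edge_def)
  \<comment> \<open>Here \<open>a / l\<close> is of order \<open>log log r / log r\<close>, so the
    error of the last round vanishes along with \<open>1 / l\<close>.\<close>
  have "?f \<longlonglongrightarrow> 1" by real_asymp
  from tendsto_sandwich[OF lower upper this tendsto_const] show "?P \<longlonglongrightarrow> 1" .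
qed simp

end
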